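(* Fix any $p\in\mathbb{N}$ and $\alpha>0$. Suppose $\mathcal{A}$ is a PAP query-release algorithm for the class $\mathcal{S}_p$ of binary decision stumps on $\{\pm1\}^p$ that takes $n$ private samples and $m$ public samples, is $(1,1/(4n))$-differentially private with respect to its private samples (for every fixed public dataset), and is $(\alpha,\alpha)$-accurate for $\mathcal{S}_p$. Then either $n=\tilde\Omega(\sqrt{p}/\alpha)$ or $m=\Omega(1/\alpha^2)$, where the implied constants and polylogarithmic factors are universal (independent of $p$, $\alpha$ and $\mathcal{A}$).
   Context: The class of binary decision stumps $\mathcal{S}_p$ consists of the functions $h_i:\{\pm1\}^p\to\{\pm1\}$, $h_i(x)=x_i$, for $i\in[p]$. A PAP query-release algorithm takes a private dataset $\vec x\in\mathcal{X}^n$ and a public dataset $\vec w\in\mathcal{X}^m$ (here $\mathcal{X}=\{\pm1\}^p$) and outputs $G:\mathcal{S}_p\to[-1,1]$. It is $(\alpha,\beta)$-accurate if for every distribution $\mathbf{D}$ on $\mathcal{X}$, with $\vec x\sim\mathbf{D}^n$, $\vec w\sim\mathbf{D}^m$, with probability at least $1-\beta$ the output satisfies $\sup_{h\in\mathcal{S}_p}|G(h)-\mathbb{E}_{x\sim\mathbf{D}}[h(x)]|\le\alpha$. It is $(\varepsilon,\delta)$-differentially private with respect to its private samples if for every fixed $\vec w$, for all private datasets $\vec x,\vec x'$ differing in one element and all output sets $Z$, $\Pr[\mathcal{A}(\vec x,\vec w)\in Z]\le e^{\varepsilon}\Pr[\mathcal{A}(\vec x',\vec w)\in Z]+\delta$.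 The notation $\tilde\Omega$ hides polylogarithmic factors.
   Formalization: The claim is proved for all α up to some universal constant rather than for every α>0, since for α=1 the algorithm that always outputs G=0 with n=1, m=0 refutes it for large p; n≥1 is also assumed so that 1/(4n) makes sense. *)

theory Defs
  imports "HOL-Probability.Probability"
begin

text \<open>Data points of the hypercube: a point x in {+-1}^p is represented as a function
  nat => real with x i in {-1,1} for i < p and x i = 0 for i >= p.
  The decision stump h_i (i < p) is evaluation at coordinate i.\<close>

definition cube :: "nat \<Rightarrow> (nat \<Rightarrow> real) set" where
  "cube p = {x. (\<forall>i<p. x i \<in> {-1, 1}) \<and> (\<forall>i\<ge>p. x i = 0)}"

definition stump :: "nat \<Rightarrow> (nat \<Rightarrow> real) \<Rightarrow> real" where
  "stump i x = x i"

definition datasets :: "nat \<Rightarrow> nat \<Rightarrow> (nat \<Rightarrow> real) list set" where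
  "datasets p k = {xs. length xs = k \<and> set xs \<subseteq> cube p}"

definition neighbours :: "'a list \<Rightarrow> 'a list \<Rightarrow> bool" where
  "neighbours xs ys \<longleftrightarrow> length xs = length ys \<and>
     card {j. j < length xs \<and> xs ! j \<noteq> ys ! j} \<le> 1"

fun iid_pmf :: "nat \<Rightarrow> 'a pmf \<Rightarrow> 'a list pmf" where
  "iid_pmf 0 D = return_pmf []"
| "iid_pmf (Suc k) D = do { x \<leftarrow> D; xs \<leftarrow> iid_pmf k D; return_pmf (x # xs) }"

text \<open>Output space: a function G : S_p -> R, represented by its values G i = G(h_i),
  i < p, with the product Borel sigma-algebra.\<close>
definition out_space :: "nat \<Rightarrow> (nat \<Rightarrow> real) measure" where
  "out_space p = PiM {0..<p} (\<lambda>_. borel)"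

definition pap_algorithm ::
  "nat \<Rightarrow> nat \<Rightarrow> nat \<Rightarrow> ((nat \<Rightarrow> real) list \<Rightarrow> (nat \<Rightarrow> real) list \<Rightarrow> (nat \<Rightarrow> real) measure) \<Rightarrow> bool" where
  "pap_algorithm p n m A \<longleftrightarrow>
     (\<forall>x\<in>datasets p n. \<forall>w\<in>datasets p m.
        prob_space (A x w) \<and> sets (A x w) = sets (out_space p) \<and>
        (AE G in A x w. \<forall>i<p. G i \<in> {-1..1}))"

definition dp_private ::
  "nat \<Rightarrow> nat \<Rightarrow> nat \<Rightarrow> real \<Rightarrow> real \<Rightarrow> ((nat \<Rightarrow> real) list \<Rightarrow> (nat \<Rightarrow> real) list \<Rightarrow> (nat \<Rightarrow> real) measure) \<Rightarrow> bool" where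
  "dp_private p n m \<epsilon> \<delta> A \<longleftrightarrow>
     (\<forall>w\<in>datasets p m. \<forall>x\<in>datasets p n. \<forall>x'\<in>datasets p n. neighbours x x' \<longrightarrow>
        (\<forall>Z\<in>sets (out_space p). measure (A x w) Z \<le> exp \<epsilon> * measure (A x' w) Z + \<delta>))"

definition accurate_set :: "nat \<Rightarrow> real \<Rightarrow> (nat \<Rightarrow> real) pmf \<Rightarrow> (nat \<Rightarrow> real) set" where
  "accurate_set p \<alpha> D = {G \<in> space (out_space p).
     \<forall>i<p. \<bar>G i - measure_pmf.expectation D (stump i)\<bar> \<le> \<alpha>}"

definition pap_accurate ::
  "nat \<Rightarrow> nat \<Rightarrow> nat \<Rightarrow> real \<Rightarrow> real \<Rightarrow> ((nat \<Rightarrow> real) list \<Rightarrow> (nat \<Rightarrow> real) list \<Rightarrow> (nat \<Rightarrow> real) measure) \<Rightarrow> bool" where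
  "pap_accurate p n m \<alpha> \<beta> A \<longleftrightarrow>
     (\<forall>D :: (nat \<Rightarrow> real) pmf. set_pmf D \<subseteq> cube p \<longrightarrow>
        measure_pmf.expectation (pair_pmf (iid_pmf n D) (iid_pmf m D))
          (\<lambda>(x, w). measure (A x w) (accurate_set p \<alpha> D)) \<ge> 1 - \<beta>)"

end

theory Submission
  imports Defs
begin

text \<open>A fingerprinting argument in which the public samples are treated as further samples of the
  algorithm. Let \<open>D\<^sub>q\<close> be the product distribution on the cube with mean vector \<open>q \<in> [-\<tau>, \<tau>]\<^sup>p\<close>,
  \<open>\<tau> = 4\<alpha>\<close>, and let \<open>g\<^sub>i(q)\<close> be the expectation of the \<open>i\<close>-th answer, truncated to \<open>[-\<tau>, \<tau>]\<close>, under
  samples from \<open>D\<^sub>q\<close>. The derivative of \<open>g\<^sub>i\<close> in \<open>q\<^sub>i\<close> is the correlation of this answer with the sum of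
  the scores \<open>y\<^sub>i / (1 + q\<^sub>i y\<^sub>i)\<close> over all private and public samples \<open>y\<close>. Accuracy forces \<open>g\<^sub>i\<close> to climb from
  about \<open>-\<tau>\<close> to about \<open>\<tau>\<close>, so by averaging over the box there is a \<open>q\<close> at which these correlations,
  summed over \<open>i\<close>, are of order \<open>p\<close>. On the other hand, truncation bounds the part of the public
  samples by \<open>p \<tau> \<surd>(2m)\<close>, and privacy, by comparison with a fresh sample, bounds the part of each
  private sample by about \<open>\<tau> \<surd>p + \<tau> p / n\<close>. Hence \<open>n\<close> is at least of order \<open>\<surd>p / \<alpha>\<close>, without logarithmic
  factors, or \<open>m\<close> is at least of order \<open>1 / \<alpha>\<^sup>2\<close>.\<close>

section \<open>Finitely supported distributions and iid samples\<close>

abbreviation E :: "'a pmf \<Rightarrow> ('a \<Rightarrow> real) \<Rightarrow> real" where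
  "E D f \<equiv> measure_pmf.expectation D f"

text \<open>Every distribution in the argument has finite support, so Fubini is the reordering of a
  finite sum and integrability is automatic.\<close>

lemma expectation_pair_finite:
  assumes "finite (set_pmf P)" "finite (set_pmf Q)"
  shows "E (pair_pmf P Q) f = E P (\<lambda>x. E Q (\<lambda>y. f (x, y)))"
proof -
  have "E (pair_pmf P Q) f = (\<Sum>(x, y)\<in>set_pmf P \<times> set_pmf Q. f (x, y) * (pmf P x * pmf Q y))"
    using assms by (subst integral_measure_pmf_real[where A = "set_pmf P \<times> set_pmf Q"])
      (auto simp: pmf_pair intro!: sum.cong)
  also have "\<dots> = (\<Sum>x\<in>set_pmf P. (\<Sum>y\<in>set_pmf Q. f (x, y) * pmf Q y) * pmf P x)"
    by (simp add: sum.cartesian_product sum_distrib_right sum_distrib_left mult_ac)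
  also have "\<dots> = E P (\<lambda>x. E Q (\<lambda>y. f (x, y)))"
    using assms by (simp add: integral_measure_pmf_real[where A = "set_pmf P"]
        integral_measure_pmf_real[where A = "set_pmf Q"])
  finally show ?thesis .
qed

lemma expectation_swap_finite:
  assumes "finite (set_pmf P)" "finite (set_pmf Q)"
  shows "E P (\<lambda>x. E Q (\<lambda>y. f x y)) = E Q (\<lambda>y. E P (\<lambda>x. f x y))"
proof -
  have "E (pair_pmf P Q) (\<lambda>(x, y). f x y) = E (pair_pmf Q P) (\<lambda>(y, x). f x y)"
    by (subst pair_commute_pmf) (simp add: case_prod_unfold)
  then show ?thesis
    using assms by (simp add: expectation_pair_finite)
qed

lemma expectation_mono_finite:
  assumes "finite (set_pmf P)" "\<And>x. x \<in> set_pmf P \<Longrightarrow> f x \<le> g x"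
  shows "E P f \<le> E P g"
  using assms by (intro integral_mono_AE integrable_measure_pmf_finite) (auto simp: AE_measure_pmf_iff)

lemma expectation_cong: "(\<And>x. x \<in> set_pmf P \<Longrightarrow> f x = g x) \<Longrightarrow> E P f = E P g"
  by (intro integral_cong_AE) (auto simp: AE_measure_pmf_iff)

text \<open>The cross term factors into \<open>2 * E P a * E Q b\<close> and vanishes because
  \<open>a\<close> is centred. Iterating this makes second moments of independent centred sums
  additive.\<close>

lemma second_moment_pair:
  assumes "finite (set_pmf P)" "finite (set_pmf Q)" "E P a = 0"
  shows "E (pair_pmf P Q) (\<lambda>(x, y). (a x + b y)\<^sup>2) = E P (\<lambda>x. (a x)\<^sup>2) + E Q (\<lambda>y. (b y)\<^sup>2)"
  using assms
  by (simp add: expectation_pair_finite power2_sum integrable_measure_pmf_finite)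

text \<open>The variance of \<open>\<bar>f x\<bar>\<close> is nonnegative.\<close>

lemma expectation_abs_le_sqrt:
  assumes "finite (set_pmf P)" "E P (\<lambda>x. (f x)\<^sup>2) \<le> v"
  shows "E P (\<lambda>x. \<bar>f x\<bar>) \<le> sqrt v"
proof -
  have "(E P (\<lambda>x. \<bar>f x\<bar>))\<^sup>2 \<le> E P (\<lambda>x. (f x)\<^sup>2)"
    using measure_pmf.variance_eq[of P "\<lambda>x. \<bar>f x\<bar>"] measure_pmf.variance_positive[of P "\<lambda>x. \<bar>f x\<bar>"] assms
    by (simp add: integrable_measure_pmf_finite)
  with assms show ?thesis by (intro real_le_rsqrt) linarith
qed

lemma iid_pmf_Suc_pair: "iid_pmf (Suc k) D = map_pmf (\<lambda>(x, xs). x # xs) (pair_pmf D (iid_pmf k D))"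
  by (simp add: pair_pmf_def map_pmf_def bind_assoc_pmf bind_return_pmf)

lemma iid_pmf_eq_replicate_pmf: "iid_pmf k D = replicate_pmf k D"
  by (induction k) auto

lemma set_iid_pmf: "set_pmf (iid_pmf k D) = {xs. set xs \<subseteq> set_pmf D \<and> length xs = k}"
  by (auto simp: iid_pmf_eq_replicate_pmf set_replicate_pmf)

lemma finite_set_iid_pmf: "finite (set_pmf D) \<Longrightarrow> finite (set_pmf (iid_pmf k D))"
  by (simp add: set_iid_pmf finite_lists_length_eq)

lemma pmf_iid_pmf: "length xs = k \<Longrightarrow> pmf (iid_pmf k D) xs = (\<Prod>x\<leftarrow>xs. pmf D x)"
proof (induction k arbitrary: xs)
  case (Suc k)
  then obtain y ys where xs: "xs = y # ys" and "length ys = k" by (cases xs) auto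
  have "pmf (iid_pmf (Suc k) D) xs = pmf (map_pmf (\<lambda>(x, xs). x # xs) (pair_pmf D (iid_pmf k D))) ((\<lambda>(x, xs). x # xs) (y, ys))"
    by (simp only: iid_pmf_Suc_pair xs prod.case)
  also have "\<dots> = pmf (pair_pmf D (iid_pmf k D)) (y, ys)"
    by (rule pmf_map_inj') (auto intro!: injI)
  finally show ?case using Suc.IH[of ys] \<open>length ys = k\<close> by (simp add: pmf_pair xs)
qed simp

lemma expectation_iid_pmf_Suc:
  assumes "finite (set_pmf D)"
  shows "E (iid_pmf (Suc k) D) f = E D (\<lambda>x. E (iid_pmf k D) (\<lambda>xs. f (x # xs)))"
  unfolding iid_pmf_Suc_pair using assms
  by (simp add: expectation_pair_finite finite_set_iid_pmf case_prod_unfold)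

text \<open>Independent centred terms are orthogonal, hence growth like \<open>k\<close> instead of
  \<open>k^2\<close>. This is the source of \<open>sqrt m\<close> in the contribution of the public
  samples.\<close>

lemma second_moment_iid_pmf:
  assumes "finite (set_pmf D)" "E D s = 0"
  shows "E (iid_pmf k D) (\<lambda>xs. (\<Sum>x\<leftarrow>xs. s x)\<^sup>2) = k * E D (\<lambda>x. (s x)\<^sup>2)"
proof (induction k)
  case (Suc k)
  have "E (iid_pmf (Suc k) D) (\<lambda>xs. (\<Sum>x\<leftarrow>xs. s x)\<^sup>2)
      = E (pair_pmf D (iid_pmf k D)) (\<lambda>(x, xs). (s x + (\<Sum>x\<leftarrow>xs. s x))\<^sup>2)"
    unfolding iid_pmf_Suc_pair by (simp add: case_prod_unfold)
  also have "\<dots> = E D (\<lambda>x. (s x)\<^sup>2) + k * E D (\<lambda>x. (s x)\<^sup>2)"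
    using assms by (simp add: second_moment_pair finite_set_iid_pmf Suc.IH)
  finally show ?case by (simp add: algebra_simps)
qed simp

text \<open>Exchangeability: a sample and a fresh copy of it may be swapped.\<close>
lemma expectation_iid_pmf_resample:
  assumes fin: "finite (set_pmf D)" and "j < k"
  shows "E (iid_pmf k D) (\<lambda>xs. E D (\<lambda>y. h (xs ! j) (xs[j := y]))) = E (iid_pmf k D) (\<lambda>xs. E D (\<lambda>y. h y xs))"
  using \<open>j < k\<close>
proof (induction k arbitrary: j h)
  case (Suc k)
  note [simp del] = iid_pmf.simps and [simp] = expectation_iid_pmf_Suc[OF fin]
  show ?case
  proof (cases j)
    case 0
    have "E D (\<lambda>x. E (iid_pmf k D) (\<lambda>xs. E D (\<lambda>y. h x (y # xs))))
        = E D (\<lambda>x. E D (\<lambda>y. E (iid_pmf k D) (\<lambda>xs. h x (y # xs))))"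
      by (simp add: expectation_swap_finite[OF finite_set_iid_pmf[OF fin] fin])
    also have "\<dots> = E D (\<lambda>y. E D (\<lambda>x. E (iid_pmf k D) (\<lambda>xs. h x (y # xs))))"
      by (rule expectation_swap_finite[OF fin fin])
    also have "\<dots> = E D (\<lambda>y. E (iid_pmf k D) (\<lambda>xs. E D (\<lambda>x. h x (y # xs))))"
      by (simp add: expectation_swap_finite[OF finite_set_iid_pmf[OF fin] fin])
    finally show ?thesis by (simp add: 0)
  next
    case (Suc i)
    then show ?thesis
      \<comment> \<open>The head of the list is a parameter here: the dummy stays schematic, so the
        induction hypothesis applies to every head.\<close>
      using Suc.prems Suc.IH[of i "\<lambda>u xs. h u (_ # xs)"] by simp
  qed
qed simp

text \<open>The same orthogonality across the coordinates of a single point. It is the source of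
  \<open>sqrt p\<close> in the contribution of each private sample.\<close>

lemma second_moment_Pi_pmf:
  assumes "finite A" and fin: "\<And>i. finite (set_pmf (p i))" and mean: "\<And>i. i \<in> A \<Longrightarrow> E (p i) (u i) = 0"
  shows "E (Pi_pmf A d p) (\<lambda>x. (\<Sum>i\<in>A. u i (x i))\<^sup>2) = (\<Sum>i\<in>A. E (p i) (\<lambda>v. (u i v)\<^sup>2))"
  using \<open>finite A\<close> mean
proof (induction A)
  case (insert k A)
  have finPi: "finite (set_pmf (Pi_pmf A d p))"
    using insert.hyps fin by (auto simp: set_Pi_pmf intro!: finite_PiE_dflt)
  have "E (Pi_pmf (insert k A) d p) (\<lambda>x. (\<Sum>i\<in>insert k A. u i (x i))\<^sup>2)
      = E (pair_pmf (p k) (Pi_pmf A d p)) (\<lambda>(v, x). (\<Sum>i\<in>insert k A. u i ((x(k := v)) i))\<^sup>2)"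
    using insert.hyps by (simp add: Pi_pmf_insert case_prod_unfold)
  also have "\<dots> = E (pair_pmf (p k) (Pi_pmf A d p)) (\<lambda>(v, x). (u k v + (\<Sum>i\<in>A. u i (x i)))\<^sup>2)"
  proof -
    have "(\<Sum>i\<in>A. u i ((x(k := v)) i)) = (\<Sum>i\<in>A. u i (x i))" for x v
      using insert.hyps by (intro sum.cong) auto
    then show ?thesis using insert.hyps by (simp del: fun_upd_apply) (simp)
  qed
  also have "\<dots> = (\<Sum>i\<in>insert k A. E (p i) (\<lambda>v. (u i v)\<^sup>2))"
    using insert fin finPi by (simp add: second_moment_pair)
  finally show ?case .
qed simp

section \<open>Differential privacy for bounded test functions\<close>

text \<open>The value \<open>f x\<close> is the length of \<open>{0..<f x}\<close>; then the order
  of integration is swapped. Restricting \<open>t\<close> to \<open>{0..B}\<close> ensures that an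
  additive error in the measure of each superlevel set costs only \<open>B\<close> times that
  error.\<close>

lemma nn_integral_layer_cake:
  fixes f :: "'a \<Rightarrow> real"
  assumes "sigma_finite_measure M" and [measurable]: "f \<in> borel_measurable M"
    and f: "\<And>x. 0 \<le> f x" "\<And>x. f x \<le> B"
  shows "(\<integral>\<^sup>+x. f x \<partial>M) = (\<integral>\<^sup>+t. emeasure M {x\<in>space M. t < f x} * indicator {0..B} t \<partial>lborel)"
proof -
  interpret pair_sigma_finite M lborel
    using assms(1) by (simp add: pair_sigma_finite_def sigma_finite_lborel)
  have "(\<integral>\<^sup>+x. f x \<partial>M) = (\<integral>\<^sup>+x. (\<integral>\<^sup>+t. indicator {0..<f x} t \<partial>lborel) \<partial>M)"
    using f by simp
  also have "\<dots> = (\<integral>\<^sup>+x. (\<integral>\<^sup>+t. indicator {0..B} t * indicator {x\<in>space M. t < f x} x \<partial>lborel) \<partial>M)"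
    using f(2) by (intro nn_integral_cong) (auto simp: indicator_def intro: less_imp_le order_trans)
  also have "\<dots> = (\<integral>\<^sup>+t. (\<integral>\<^sup>+x. indicator {0..B} t * indicator {x\<in>space M. t < f x} x \<partial>M) \<partial>lborel)"
    by (rule Fubini'[symmetric]) (simp add: indicator_def)
  also have "\<dots> = (\<integral>\<^sup>+t. emeasure M {x\<in>space M. t < f x} * indicator {0..B} t \<partial>lborel)"
    by (intro nn_integral_cong) (simp add: nn_integral_cmult mult.commute)
  finally show ?thesis .
qed

text \<open>The inequality for events is applied to each superlevel set of \<open>f\<close> and
  integrated over the levels in \<open>{0..B}\<close>.\<close>

lemma dp_integral_nonneg_le:
  fixes f :: "'a \<Rightarrow> real"
  assumes "prob_space M" "prob_space N" and sets: "sets M = sets N"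
    and dp: "\<And>Z. Z \<in> sets N \<Longrightarrow> measure M Z \<le> c * measure N Z + \<delta>"
    and f: "f \<in> borel_measurable N" "\<And>x. 0 \<le> f x" "\<And>x. f x \<le> B"
    and "0 \<le> c" "0 \<le> \<delta>"
  shows "(\<integral>x. f x \<partial>M) \<le> c * (\<integral>x. f x \<partial>N) + \<delta> * B"
proof -
  interpret M: prob_space M by fact
  interpret N: prob_space N by fact
  have fM: "f \<in> borel_measurable M" and [measurable]: "f \<in> borel_measurable N"
    using f(1) measurable_cong_sets[OF sets refl] by auto
  have space: "space M = space N" by (rule sets_eq_imp_space_eq) fact
  have "0 \<le> B" using f(2,3) order_trans by blast
  have "(\<integral>\<^sup>+x. f x \<partial>M) = (\<integral>\<^sup>+t. emeasure M {x\<in>space N. t < f x} * indicator {0..B} t \<partial>lborel)"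
    using nn_integral_layer_cake[OF M.sigma_finite_measure_axioms fM f(2,3)] by (simp add: space)
  also have "\<dots> \<le> (\<integral>\<^sup>+t. ennreal c * (emeasure N {x\<in>space N. t < f x} * indicator {0..B} t) + ennreal \<delta> * indicator {0..B} t \<partial>lborel)"
  proof (rule nn_integral_mono)
    fix t
    have "emeasure M {x\<in>space N. t < f x} \<le> ennreal c * emeasure N {x\<in>space N. t < f x} + ennreal \<delta>"
      using dp[of "{x\<in>space N. t < f x}"] \<open>0 \<le> c\<close> \<open>0 \<le> \<delta>\<close>
      by (simp add: M.emeasure_eq_measure N.emeasure_eq_measure ennreal_mult[symmetric] ennreal_plus[symmetric] del: ennreal_plus)
    then show "emeasure M {x\<in>space N. t < f x} * indicator {0..B} t
      \<le> ennreal c * (emeasure N {x\<in>space N. t < f x} * indicator {0..B} t) + ennreal \<delta> * indicator {0..B} t"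
      by (auto simp: indicator_def)
  qed
  also have "\<dots> = ennreal c * (\<integral>\<^sup>+x. f x \<partial>N) + ennreal \<delta> * ennreal B"
    using \<open>0 \<le> B\<close> nn_integral_layer_cake[OF N.sigma_finite_measure_axioms f]
    by (subst nn_integral_add) (auto simp: nn_integral_cmult)
  finally have "ennreal (\<integral>x. f x \<partial>M) \<le> ennreal (c * (\<integral>x. f x \<partial>N) + \<delta> * B)"
  proof -
    have "integrable M f" "integrable N f"
      using f fM by (auto intro!: M.integrable_const_bound[where B = B] N.integrable_const_bound[where B = B])
    then show "(\<integral>\<^sup>+x. f x \<partial>M) \<le> ennreal c * (\<integral>\<^sup>+x. f x \<partial>N) + ennreal \<delta> * ennreal B \<Longrightarrow> ?thesis"
      using f \<open>0 \<le> c\<close> \<open>0 \<le> \<delta>\<close> \<open>0 \<le> B\<close>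
      by (simp add: nn_integral_eq_integral ennreal_mult ennreal_plus)
  qed
  then show ?thesis
    using f \<open>0 \<le> c\<close> \<open>0 \<le> \<delta>\<close> \<open>0 \<le> B\<close> by (subst (asm) ennreal_le_iff) auto
qed

text \<open>The positive part of \<open>f\<close> is compared from \<open>M\<close> to
  \<open>N\<close> and the negative part from \<open>N\<close> to \<open>M\<close>. The integral of
  \<open>f\<close> itself enters with coefficient exactly 1, so that it can average out to zero
  later; only the excess factor meets the absolute value.\<close>

lemma dp_integral_le:
  fixes f :: "'a \<Rightarrow> real"
  assumes M: "prob_space M" and N: "prob_space N" and sets: "sets M = sets N"
    and dp: "\<And>Z. Z \<in> sets N \<Longrightarrow> measure M Z \<le> exp \<epsilon> * measure N Z + \<delta>"
      "\<And>Z. Z \<in> sets N \<Longrightarrow> measure N Z \<le> exp \<epsilon> * measure M Z + \<delta>"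
    and f [measurable]: "f \<in> borel_measurable N" and B: "\<And>x. \<bar>f x\<bar> \<le> B"
    and "0 \<le> \<epsilon>" "0 \<le> \<delta>"
  shows "(\<integral>x. f x \<partial>M) \<le> (\<integral>x. f x \<partial>N) + (exp \<epsilon> - 1) * (\<integral>x. \<bar>f x\<bar> \<partial>N) + 2 * \<delta> * B"
proof -
  interpret M: prob_space M by fact
  interpret N: prob_space N by fact
  define pos neg where "pos = (\<lambda>x. max 0 (f x))" and "neg = (\<lambda>x. max 0 (- f x))"
  have fM [measurable]: "f \<in> borel_measurable M"
    using f unfolding measurable_cong_sets[OF sets refl] .
  have "0 \<le> B" using B abs_ge_zero order_trans by blast
  have bounds: "0 \<le> pos x" "pos x \<le> B" "0 \<le> neg x" "neg x \<le> B" for x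
    using B[of x] \<open>0 \<le> B\<close> by (auto simp: pos_def neg_def)
  have meas: "pos \<in> borel_measurable N" "neg \<in> borel_measurable M" "neg \<in> borel_measurable N" "pos \<in> borel_measurable M"
    by (auto simp: pos_def neg_def)
  have int: "integrable M pos" "integrable M neg" "integrable N pos" "integrable N neg"
    using bounds meas
    by (auto intro!: M.integrable_const_bound[where B = B] N.integrable_const_bound[where B = B])
  have split: "f x = pos x - neg x" "\<bar>f x\<bar> = pos x + neg x" for x
    by (auto simp: pos_def neg_def)
  define P Q P' Q' where "P = (\<integral>x. pos x \<partial>M)" and "Q = (\<integral>x. neg x \<partial>M)"
    and "P' = (\<integral>x. pos x \<partial>N)" and "Q' = (\<integral>x. neg x \<partial>N)"
  have P: "P \<le> exp \<epsilon> * P' + \<delta> * B"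
    unfolding P_def P'_def using dp(1) bounds meas \<open>0 \<le> \<delta>\<close>
    by (intro dp_integral_nonneg_le[OF M N sets]) auto
  have "Q' \<le> exp \<epsilon> * Q + \<delta> * B"
    unfolding Q_def Q'_def using dp(2) bounds meas \<open>0 \<le> \<delta>\<close>
    by (intro dp_integral_nonneg_le[OF N M sets[symmetric]]) (auto simp: sets)
  \<comment> \<open>The negative part enters with a minus sign, so a lower bound on \<open>Q\<close>
    is wanted: the reverse privacy inequality is divided by \<open>exp \<epsilon>\<close>.\<close>
  then have "exp (-\<epsilon>) * Q' \<le> exp (-\<epsilon>) * (exp \<epsilon> * Q + \<delta> * B)"
    by (intro mult_left_mono) auto
  also have "\<dots> = Q + exp (-\<epsilon>) * (\<delta> * B)"
    by (simp add: algebra_simps exp_minus)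
  also have "\<dots> \<le> Q + \<delta> * B"
    using \<open>0 \<le> \<epsilon>\<close> \<open>0 \<le> \<delta>\<close> \<open>0 \<le> B\<close> mult_right_mono[of "exp (-\<epsilon>)" 1 "\<delta> * B"] by simp
  finally have Q: "exp (-\<epsilon>) * Q' \<le> Q + \<delta> * B" .
  \<comment> \<open>Equivalently \<open>1 - exp (-\<epsilon>) \<le> exp \<epsilon> - 1\<close>, so
    the loss on the negative part is covered by the same factor as the loss on the positive
    part.\<close>
  have "2 \<le> exp \<epsilon> + exp (-\<epsilon>)"
    using exp_ge_add_one_self[of \<epsilon>] exp_ge_add_one_self[of "-\<epsilon>"] by linarith
  moreover have "0 \<le> Q'" using bounds by (simp add: Q'_def)
  ultimately have "2 * Q' \<le> (exp \<epsilon> + exp (-\<epsilon>)) * Q'"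
    by (rule mult_right_mono)
  with P Q have "P - Q \<le> P' - Q' + (exp \<epsilon> - 1) * (P' + Q') + 2 * \<delta> * B"
    by (simp add: algebra_simps)
  then show ?thesis
    using int unfolding P_def Q_def P'_def Q'_def by (simp add: split(2)) (simp add: split(1))
qed

lemma neighbours_list_update: "neighbours x (x[j := y])" "neighbours (x[j := y]) x"
proof -
  have "card {i. i < length x \<and> x ! i \<noteq> x[j := y] ! i} \<le> card {j}"
    by (rule card_mono) (auto, metis nth_list_update_neq)
  then show "neighbours x (x[j := y])" "neighbours (x[j := y]) x"
    by (auto simp: neighbours_def eq_commute)
qed

text \<open>Privacy lets the \<open>j\<close>-th sample be replaced inside the mechanism by a fresh one; what remains is
  independent of the sample it is tested against.\<close>
lemma dp_correlation_le:
  fixes M :: "'a list \<Rightarrow> 'b measure" and \<phi> :: "'a \<Rightarrow> 'b \<Rightarrow> real"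
  assumes fin: "finite (set_pmf D)"
    and prob: "\<And>x. x \<in> set_pmf (iid_pmf n D) \<Longrightarrow> prob_space (M x)"
    and sets: "\<And>x. x \<in> set_pmf (iid_pmf n D) \<Longrightarrow> sets (M x) = sets N"
    and dp: "\<And>x x' Z. x \<in> set_pmf (iid_pmf n D) \<Longrightarrow> x' \<in> set_pmf (iid_pmf n D) \<Longrightarrow>
      neighbours x x' \<Longrightarrow> Z \<in> sets N \<Longrightarrow> measure (M x) Z \<le> exp \<epsilon> * measure (M x') Z + \<delta>"
    and \<phi>: "\<And>y. y \<in> set_pmf D \<Longrightarrow> \<phi> y \<in> borel_measurable N"
      "\<And>y G. y \<in> set_pmf D \<Longrightarrow> \<bar>\<phi> y G\<bar> \<le> B"
    and mean: "\<And>G. E D (\<lambda>y. \<phi> y G) = 0"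
    and V: "\<And>G. E D (\<lambda>y. \<bar>\<phi> y G\<bar>) \<le> V"
    and "j < n" "0 \<le> \<epsilon>" "0 \<le> \<delta>"
  shows "E (iid_pmf n D) (\<lambda>x. \<integral>G. \<phi> (x ! j) G \<partial>M x) \<le> (exp \<epsilon> - 1) * V + 2 * \<delta> * B"
proof -
  \<comment> \<open>The bound of \<open>dp_integral_le\<close> for a test against \<open>y\<close>
    while the mechanism runs on \<open>x\<close>. It is first used with the old sample
    \<open>x ! j\<close> as test point and the modified input \<open>x[j := y]\<close>.\<close>
  define h where "h y x = (\<integral>G. \<phi> y G \<partial>M x) + (exp \<epsilon> - 1) * (\<integral>G. \<bar>\<phi> y G\<bar> \<partial>M x) + 2 * \<delta> * B" for y x
  note finiid = finite_set_iid_pmf[OF fin]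
  have int: "integrable (M x) (\<phi> y)" if "y \<in> set_pmf D" "x \<in> set_pmf (iid_pmf n D)" for x y
  proof -
    interpret prob_space "M x" by (rule prob) fact
    show ?thesis
      using \<phi>[OF that(1)] measurable_cong_sets[OF sets[OF that(2)] refl]
      by (intro integrable_const_bound[where B = B]) auto
  qed
  have "(\<integral>G. \<phi> (x ! j) G \<partial>M x) \<le> h (x ! j) (x[j := y])"
    if x: "x \<in> set_pmf (iid_pmf n D)" and y: "y \<in> set_pmf D" for x y
  proof -
    have x': "x[j := y] \<in> set_pmf (iid_pmf n D)"
      using x y set_update_subset_insert[of x j y] by (auto simp: set_iid_pmf)
    have xj: "x ! j \<in> set_pmf D"
      using x \<open>j < n\<close> nth_mem by (auto simp: set_iid_pmf)
    show ?thesis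
      unfolding h_def
      using dp[OF x x'] dp[OF x' x] neighbours_list_update[of x j y] \<phi>[OF xj] \<open>0 \<le> \<epsilon>\<close> \<open>0 \<le> \<delta>\<close>
        measurable_cong_sets[OF sets[OF x'] refl, of borel]
      by (intro dp_integral_le prob x x') (auto simp: sets[OF x] sets[OF x'])
  qed
  then have "E D (\<lambda>y. \<integral>G. \<phi> (x ! j) G \<partial>M x) \<le> E D (\<lambda>y. h (x ! j) (x[j := y]))"
    if "x \<in> set_pmf (iid_pmf n D)" for x
    using that fin by (intro expectation_mono_finite) auto
  then have "E (iid_pmf n D) (\<lambda>x. \<integral>G. \<phi> (x ! j) G \<partial>M x)
      \<le> E (iid_pmf n D) (\<lambda>x. E D (\<lambda>y. h (x ! j) (x[j := y])))"
    using finiid by (intro expectation_mono_finite) auto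
  \<comment> \<open>After the exchange the test point is the fresh sample and is independent of the
    input of the mechanism.\<close>
  also have "\<dots> = E (iid_pmf n D) (\<lambda>x. E D (\<lambda>y. h y x))"
    by (rule expectation_iid_pmf_resample) fact+
  also have "\<dots> \<le> E (iid_pmf n D) (\<lambda>x. (exp \<epsilon> - 1) * V + 2 * \<delta> * B)"
  proof (intro expectation_mono_finite finiid)
    fix x assume x: "x \<in> set_pmf (iid_pmf n D)"
    interpret prob_space "M x" by (rule prob) fact
    have swap: "E D (\<lambda>y. \<integral>G. f (\<phi> y G) \<partial>M x) = (\<integral>G. E D (\<lambda>y. f (\<phi> y G)) \<partial>M x)"
      if "\<And>y. y \<in> set_pmf D \<Longrightarrow> integrable (M x) (\<lambda>G. f (\<phi> y G))" for f :: "real \<Rightarrow> real"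
      using fin that by (simp add: integral_measure_pmf_real[where A = "set_pmf D"])
    \<comment> \<open>With the input fixed, the average over the fresh sample moves inside the
      integral over \<open>G\<close>, where \<open>mean\<close> removes the first term and
      \<open>V\<close> controls the second.\<close>
    have "E D (\<lambda>y. h y x) = (\<integral>G. E D (\<lambda>y. \<phi> y G) \<partial>M x)
        + (exp \<epsilon> - 1) * (\<integral>G. E D (\<lambda>y. \<bar>\<phi> y G\<bar>) \<partial>M x) + 2 * \<delta> * B"
      using fin swap[of "\<lambda>v. v"] swap[of abs] int[OF _ x] by (simp add: h_def integrable_measure_pmf_finite)
    also have "(\<integral>G. E D (\<lambda>y. \<bar>\<phi> y G\<bar>) \<partial>M x) \<le> (\<integral>G. V \<partial>M x)"
      using fin int[OF _ x] V
      by (intro integral_mono) (auto simp: integral_measure_pmf_real[where A = "set_pmf D"])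
    finally show "E D (\<lambda>y. h y x) \<le> (exp \<epsilon> - 1) * V + 2 * \<delta> * B"
      using \<open>0 \<le> \<epsilon>\<close> mean by (simp add: mult_left_mono prob_space)
  qed
  finally show ?thesis by simp
qed

section \<open>Averaging a divergence over a box\<close>

text \<open>Fundamental theorem of calculus, divided by the length of the interval. The second
  conjunct is what makes this average integrable in the remaining coordinates later.\<close>

lemma expectation_deriv_uniform:
  fixes u v :: "real \<Rightarrow> real"
  assumes "0 < \<tau>" and [measurable]: "v \<in> borel_measurable borel"
    and bound: "\<And>t. t \<in> {-\<tau>..\<tau>} \<Longrightarrow> \<bar>v t\<bar> \<le> K"
    and deriv: "\<And>t. t \<in> {-\<tau>..\<tau>} \<Longrightarrow> (u has_real_derivative v t) (at t)"
  shows "(\<integral>t. v t \<partial>uniform_measure lborel {-\<tau>..\<tau>}) = (u \<tau> - u (-\<tau>)) / (2 * \<tau>)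
    \<and> \<bar>\<integral>t. v t \<partial>uniform_measure lborel {-\<tau>..\<tau>}\<bar> \<le> K"
proof
  have "(v has_integral (u \<tau> - u (-\<tau>))) {-\<tau>..\<tau>}"
    using \<open>0 < \<tau>\<close> deriv
    by (intro fundamental_theorem_of_calculus)
      (auto simp: has_real_derivative_iff_has_vector_derivative[symmetric] intro: has_field_derivative_at_within)
  moreover have "set_integrable lborel {-\<tau>..\<tau>} v"
    unfolding set_integrable_def
    by (rule integrableI_bounded_set_indicator[where B = K]) (use \<open>0 < \<tau>\<close> bound in auto)
  ultimately have I: "(LINT t:{-\<tau>..\<tau>}|lborel. v t) = u \<tau> - u (-\<tau>)"
    by (simp add: set_borel_integral_eq_integral integral_unique)
  have "uniform_measure lborel {-\<tau>..\<tau>} = density lborel (\<lambda>t. ennreal (indicator {-\<tau>..\<tau>} t / (2 * \<tau>)))"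
    unfolding uniform_measure_def using \<open>0 < \<tau>\<close>
    by (intro density_cong) (auto simp: indicator_def divide_ennreal[symmetric] ennreal_1[symmetric] simp del: ennreal_1)
  then have "(\<integral>t. v t \<partial>uniform_measure lborel {-\<tau>..\<tau>}) = (\<integral>t. indicator {-\<tau>..\<tau>} t / (2 * \<tau>) * v t \<partial>lborel)"
    using \<open>0 < \<tau>\<close> by (simp add: integral_density)
  also have "\<dots> = (LINT t:{-\<tau>..\<tau>}|lborel. v t) / (2 * \<tau>)"
    unfolding set_lebesgue_integral_def by (simp)
  finally show "(\<integral>t. v t \<partial>uniform_measure lborel {-\<tau>..\<tau>}) = (u \<tau> - u (-\<tau>)) / (2 * \<tau>)"
    by (simp add: I)
next
  interpret prob_space "uniform_measure lborel {-\<tau>..\<tau>}"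
    using \<open>0 < \<tau>\<close> by (intro prob_space_uniform_measure) auto
  have AE: "AE t in uniform_measure lborel {-\<tau>..\<tau>}. \<bar>v t\<bar> \<le> K"
    by (rule AE_uniform_measureI) (use bound in auto)
  then have "integrable (uniform_measure lborel {-\<tau>..\<tau>}) v"
    by (intro integrable_const_bound[where B = K]) auto
  then have "\<bar>\<integral>t. v t \<partial>uniform_measure lborel {-\<tau>..\<tau>}\<bar> \<le> (\<integral>t. \<bar>v t\<bar> \<partial>uniform_measure lborel {-\<tau>..\<tau>})"
    using integral_norm_bound[of "uniform_measure lborel {-\<tau>..\<tau>}" v] by simp
  also have "\<dots> \<le> K"
    using AE \<open>integrable _ v\<close> by (intro integral_le_const) auto
  finally show "\<bar>\<integral>t. v t \<partial>uniform_measure lborel {-\<tau>..\<tau>}\<bar> \<le> K" .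
qed

text \<open>Draw \<open>q\<close> uniformly from the box. Along each line in direction
  \<open>i\<close>, the average of \<open>F i\<close> is the difference of \<open>g i\<close>
  between opposite faces divided by the width \<open>2 * \<tau>\<close>. The sum therefore has mean
  at least the claimed value, and some point reaches it.\<close>

lemma exists_box_divergence_ge:
  fixes g F :: "nat \<Rightarrow> (nat \<Rightarrow> real) \<Rightarrow> real" and p :: nat and \<tau> K c :: real
  defines "Q \<equiv> {..<p} \<rightarrow>\<^sub>E {-\<tau>..\<tau>}"
  assumes "0 < \<tau>"
    and meas: "\<And>i. i < p \<Longrightarrow> F i \<in> borel_measurable (PiM {..<p} (\<lambda>_. borel))"
    and bound: "\<And>i q. i < p \<Longrightarrow> q \<in> Q \<Longrightarrow> \<bar>F i q\<bar> \<le> K"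
    and deriv: "\<And>i q. i < p \<Longrightarrow> q \<in> Q \<Longrightarrow> ((\<lambda>t. g i (q(i := t))) has_real_derivative F i q) (at (q i))"
    and flux: "\<And>i q. i < p \<Longrightarrow> q \<in> Q \<Longrightarrow> c \<le> g i (q(i := \<tau>)) - g i (q(i := -\<tau>))"
  shows "\<exists>q\<in>Q. p * (c / (2 * \<tau>)) \<le> (\<Sum>i<p. F i q)"
proof (rule ccontr)
  assume contra: "\<not> ?thesis"
  define U where "U = uniform_measure lborel {-\<tau>..\<tau>}"
  have U: "prob_space U"
    unfolding U_def using \<open>0 < \<tau>\<close> by (intro prob_space_uniform_measure) auto
  have sets_U [simp, measurable_cong]: "sets U = sets borel" by (simp add: U_def)
  have space_U [simp]: "space U = UNIV" by (simp add: U_def)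
  interpret P: product_prob_space "\<lambda>_. U"
    using U by (simp add: product_prob_space_def product_prob_space_axioms_def product_sigma_finite_def prob_space_imp_sigma_finite)
  have AE_box: "AE q in PiM I (\<lambda>_. U). \<forall>i\<in>I. q i \<in> {-\<tau>..\<tau>}" if "finite I" for I :: "nat set"
  proof -
    have "AE t in U. t \<in> {-\<tau>..\<tau>}"
      unfolding U_def by (rule AE_uniform_measureI) auto
    then have "AE q in PiM I (\<lambda>_. U). q i \<in> {-\<tau>..\<tau>}" if "i \<in> I" for i
      using U that by (intro AE_PiM_component[of I "\<lambda>_. U" i "\<lambda>t. t \<in> {-\<tau>..\<tau>}"])
    then show ?thesis using \<open>finite I\<close> by (simp add: AE_finite_all)
  qed
  let ?P = "PiM {..<p} (\<lambda>_. U)"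
  interpret PP: prob_space ?P by (intro prob_space_PiM U)
  have sets_P: "sets ?P = sets (PiM {..<p} (\<lambda>_. borel))" by (intro sets_PiM_cong) auto
  have measF [measurable]: "F i \<in> borel_measurable ?P" if "i < p" for i
    using meas[OF that] measurable_cong_sets[OF sets_P refl] by auto
  have inbox: "AE q in ?P. q \<in> Q"
    using AE_box[OF finite_lessThan] AE_space[of ?P]
    by eventually_elim (auto simp: Q_def space_PiM PiE_iff)
  have intF: "integrable ?P (F i)" if "i < p" for i
    using that inbox bound by (intro PP.integrable_const_bound[where B = K]) auto
  have ge: "c / (2 * \<tau>) \<le> (\<integral>q. F i q \<partial>?P)" if i: "i < p" for i
  proof -
    define I where "I = {..<p} - {i}"
    have ins: "{..<p} = insert i I" "finite I" "i \<notin> I" using i by (auto simp: I_def)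
    interpret PI: prob_space "PiM I (\<lambda>_. U)" by (intro prob_space_PiM U)
    \<comment> \<open>One-dimensional average in direction \<open>i\<close> with the other
      coordinates frozen; Fubini puts it together with the average over those coordinates.\<close>
    have inner: "c / (2 * \<tau>) \<le> (\<integral>t. F i (q(i := t)) \<partial>U) \<and> \<bar>\<integral>t. F i (q(i := t)) \<partial>U\<bar> \<le> K"
      if q: "q \<in> I \<rightarrow>\<^sub>E {-\<tau>..\<tau>}" for q
    proof -
      have upd: "q(i := t) \<in> Q" if "t \<in> {-\<tau>..\<tau>}" for t
        using q that by (auto simp: Q_def ins PiE_iff extensional_def)
      have "(\<integral>t. F i (q(i := t)) \<partial>U) = (g i (q(i := \<tau>)) - g i (q(i := -\<tau>))) / (2 * \<tau>)
          \<and> \<bar>\<integral>t. F i (q(i := t)) \<partial>U\<bar> \<le> K"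
        unfolding U_def
      proof (rule expectation_deriv_uniform[where K = K and u = "\<lambda>t. g i (q(i := t))"])
        have "(\<lambda>t. q(i := t)) \<in> measurable U ?P"
          using q unfolding ins(1)
          by (intro measurable_fun_upd[where J = I]) (auto simp: space_PiM PiE_iff)
        from measurable_comp[OF this measF[OF i]]
        show "(\<lambda>t. F i (q(i := t))) \<in> borel_measurable borel"
          by (simp add: comp_def measurable_cong_sets[OF sets_U refl])
      next
        fix t assume "t \<in> {-\<tau>..\<tau>}"
        then show "\<bar>F i (q(i := t))\<bar> \<le> K" "((\<lambda>t. g i (q(i := t))) has_real_derivative F i (q(i := t))) (at t)"
          using bound[OF i upd] deriv[OF i upd[of t]] by auto
      qed fact
      then show ?thesis using flux[OF i upd[of \<tau>]] \<open>0 < \<tau>\<close> by (auto intro!: divide_right_mono)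
    qed
    have "c / (2 * \<tau>) = (\<integral>q. c / (2 * \<tau>) \<partial>PiM I (\<lambda>_. U))" by (simp add: PI.prob_space)
    also have "\<dots> \<le> (\<integral>q. (\<integral>t. F i (q(i := t)) \<partial>U) \<partial>PiM I (\<lambda>_. U))"
    proof (rule integral_mono_AE)
      show "integrable (PiM I (\<lambda>_. U)) (\<lambda>q. \<integral>t. F i (q(i := t)) \<partial>U)"
      proof (rule PI.integrable_const_bound[where B = K])
        have "(\<lambda>z. (fst z)(i := snd z)) \<in> measurable (PiM I (\<lambda>_. U) \<Otimes>\<^sub>M U) ?P"
          using measurable_add_dim[of i I "\<lambda>_. U"] by (simp add: ins(1) case_prod_unfold)
        from measurable_comp[OF this measF[OF i]]
        show "(\<lambda>q. \<integral>t. F i (q(i := t)) \<partial>U) \<in> borel_measurable (PiM I (\<lambda>_. U))"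
          by (intro sigma_finite_measure.borel_measurable_lebesgue_integral prob_space_imp_sigma_finite U)
            (simp add: comp_def case_prod_unfold)
        show "AE q in PiM I (\<lambda>_. U). norm (\<integral>t. F i (q(i := t)) \<partial>U) \<le> K"
          using AE_box[OF ins(2)] AE_space
        proof eventually_elim
          case (elim q)
          then have "q \<in> I \<rightarrow>\<^sub>E {-\<tau>..\<tau>}" by (auto simp: space_PiM PiE_iff)
          from inner[OF this] show ?case by simp
        qed
      qed
      show "AE q in PiM I (\<lambda>_. U). c / (2 * \<tau>) \<le> (\<integral>t. F i (q(i := t)) \<partial>U)"
        using AE_box[OF ins(2)] AE_space
      proof eventually_elim
        case (elim q)
        then have "q \<in> I \<rightarrow>\<^sub>E {-\<tau>..\<tau>}" by (auto simp: space_PiM PiE_iff)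
        from inner[OF this] show ?case by simp
      qed
    qed simp
    also have "\<dots> = (\<integral>q. F i q \<partial>?P)"
      using P.product_integral_insert[of I i "F i"] ins intF[OF i] by simp
    finally show ?thesis .
  qed
  have "p * (c / (2 * \<tau>)) \<le> (\<Sum>i<p. \<integral>q. F i q \<partial>?P)"
    using sum_mono[of "{..<p}" "\<lambda>_. c / (2 * \<tau>)"] ge by simp
  also have "\<dots> = (\<integral>q. (\<Sum>i<p. F i q) \<partial>?P)"
    using intF by simp
  \<comment> \<open>If no point of the box reached the bound, the integrand would be strictly
    smaller almost everywhere, and so would be its mean.\<close>
  also have "\<dots> < (\<integral>q. p * (c / (2 * \<tau>)) \<partial>?P)"
  proof (rule PP.integral_less_AE_space)
    show "AE q in ?P. (\<Sum>i<p. F i q) < p * (c / (2 * \<tau>))"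
      using inbox contra by (auto simp: not_le elim: eventually_mono)
  qed (use intF in \<open>auto simp: PP.emeasure_space_1\<close>)
  finally show False by (simp add: PP.prob_space)
qed

section \<open>Product distributions on the cube and their scores\<close>

text \<open>Projection onto \<open>{-\<tau>..\<tau>}\<close>: it reduces the size of the answers to
  the order of the accuracy and keeps both ends of the range of means.\<close>

definition trunc_at :: "real \<Rightarrow> real \<Rightarrow> real" where
  "trunc_at \<tau> g = max (- \<tau>) (min \<tau> g)"

text \<open>The derivative in \<open>t\<close> of the logarithm of \<open>(1 + t * v) / 2\<close>,
  which is the mass of a sign \<open>v\<close> under mean \<open>t\<close>.\<close>

definition score :: "real \<Rightarrow> real \<Rightarrow> real" where
  "score t v = v / (1 + t * v)"

text \<open>The law of a random sign with mean \<open>t\<close>, for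
  \<open>\<bar>t\<bar> \<le> 1\<close>.\<close>

definition bias_pmf :: "real \<Rightarrow> real pmf" where
  "bias_pmf t = map_pmf (\<lambda>b. if b then 1 else -1) (bernoulli_pmf ((1 + t) / 2))"

text \<open>The default value 0 is the one that \<open>cube\<close> prescribes for coordinates from
  \<open>p\<close> on.\<close>

definition cube_pmf :: "nat \<Rightarrow> (nat \<Rightarrow> real) \<Rightarrow> (nat \<Rightarrow> real) pmf" where
  "cube_pmf p q = Pi_pmf {..<p} 0 (\<lambda>i. bias_pmf (q i))"

text \<open>The mass of \<open>y\<close> as a polynomial in \<open>q\<close>. It agrees with the pmf
  for means in \<open>{-1..1}\<close>, and as a polynomial it can be differentiated and is
  measurable everywhere.\<close>

definition cube_weight :: "nat \<Rightarrow> (nat \<Rightarrow> real) \<Rightarrow> (nat \<Rightarrow> real) \<Rightarrow> real" where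
  "cube_weight p q y = (\<Prod>i<p. (1 + q i * y i) / 2)"

lemma abs_trunc_at_le: "0 \<le> \<tau> \<Longrightarrow> \<bar>trunc_at \<tau> g\<bar> \<le> \<tau>"
  by (auto simp: trunc_at_def)

lemma borel_measurable_trunc_at [measurable (raw)]:
  "f \<in> borel_measurable M \<Longrightarrow> (\<lambda>x. trunc_at \<tau> (f x)) \<in> borel_measurable M"
  unfolding trunc_at_def by (intro borel_measurable_max borel_measurable_min borel_measurable_const)

lemma expectation_bias_pmf:
  "\<bar>t\<bar> \<le> 1 \<Longrightarrow> E (bias_pmf t) f = (1 + t) / 2 * f 1 + (1 - t) / 2 * f (-1)"
  by (auto simp: bias_pmf_def field_simps)

lemma finite_set_bias_pmf: "finite (set_pmf (bias_pmf t))"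
  by (simp add: bias_pmf_def)

lemma set_bias_pmf: "set_pmf (bias_pmf t) \<subseteq> {-1, 1}"
  by (auto simp: bias_pmf_def)

lemma pmf_bias_pmf:
  assumes "\<bar>t\<bar> \<le> 1" "v \<in> {-1, 1}"
  shows "pmf (bias_pmf t) v = (1 + t * v) / 2"
proof -
  have "pmf (bias_pmf t) v = E (bias_pmf t) (indicator {v})"
    by (simp add: pmf.rep_eq)
  also have "\<dots> = (1 + t * v) / 2"
    unfolding expectation_bias_pmf[OF assms(1)] using assms(2) by (auto simp: indicator_def)
  finally show ?thesis .
qed

lemma expectation_score: "\<bar>t\<bar> < 1 \<Longrightarrow> E (bias_pmf t) (score t) = 0"
  by (auto simp: expectation_bias_pmf score_def field_simps)

text \<open>This is the Fisher information \<open>1 / (1 - t^2)\<close>; both of its partial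
  fractions are at most 1 in the given range.\<close>

lemma expectation_score_square_le:
  assumes "\<bar>t\<bar> \<le> 1 / 2"
  shows "E (bias_pmf t) (\<lambda>v. (score t v)\<^sup>2) \<le> 2"
proof -
  have "E (bias_pmf t) (\<lambda>v. (score t v)\<^sup>2) = 1 / (2 * (1 + t)) + 1 / (2 * (1 - t))"
    using assms by (simp add: expectation_bias_pmf score_def power2_eq_square divide_simps)
  also have "\<dots> \<le> 1 + 1"
    using assms by (intro add_mono) (auto simp: divide_simps)
  finally show ?thesis by simp
qed

lemma abs_score_le: "\<bar>t\<bar> \<le> 1 / 2 \<Longrightarrow> v \<in> {-1, 1} \<Longrightarrow> \<bar>score t v\<bar> \<le> 2"
  by (auto simp: score_def divide_simps)

lemma set_cube_pmf: "set_pmf (cube_pmf p q) \<subseteq> cube p"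
proof
  fix x assume "x \<in> set_pmf (cube_pmf p q)"
  then have "\<forall>i<p. x i \<in> set_pmf (bias_pmf (q i))" "\<forall>i\<ge>p. x i = 0"
    by (auto simp: cube_pmf_def set_Pi_pmf PiE_dflt_def not_less)
  then show "x \<in> cube p"
    using set_bias_pmf by (auto simp: cube_def subset_iff)
qed

lemma finite_cube: "finite (cube p)"
proof (rule finite_subset)
  show "cube p \<subseteq> PiE_dflt {..<p} 0 (\<lambda>_. {-1, 1})"
    by (auto simp: cube_def PiE_dflt_def)
qed (auto intro!: finite_PiE_dflt)

lemma finite_set_cube_pmf: "finite (set_pmf (cube_pmf p q))"
  using finite_cube set_cube_pmf by (rule finite_subset[rotated])

lemma finite_datasets: "finite (datasets p k)"
  unfolding datasets_def using finite_lists_length_eq[OF finite_cube] by (simp add: conj_commute)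

lemma set_iid_cube_pmf: "set_pmf (iid_pmf k (cube_pmf p q)) \<subseteq> datasets p k"
  using set_cube_pmf by (force simp: set_iid_pmf datasets_def)

lemma pmf_cube_pmf:
  assumes "\<And>i. i < p \<Longrightarrow> \<bar>q i\<bar> \<le> 1" "y \<in> cube p"
  shows "pmf (cube_pmf p q) y = cube_weight p q y"
  using assms by (auto simp: cube_pmf_def pmf_Pi cube_weight_def cube_def pmf_bias_pmf intro!: prod.cong)

lemma expectation_cube_pmf_coord:
  assumes "i < p"
  shows "E (cube_pmf p q) (\<lambda>x. f (x i)) = E (bias_pmf (q i)) f"
proof -
  have "E (cube_pmf p q) (\<lambda>x. f (x i)) = E (map_pmf (\<lambda>x. x i) (cube_pmf p q)) f" by simp
  also have "map_pmf (\<lambda>x. x i) (cube_pmf p q) = bias_pmf (q i)"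
    using assms by (simp add: cube_pmf_def Pi_pmf_component)
  finally show ?thesis .
qed

section \<open>Differentiating expectations in the mean vector\<close>

text \<open>The index set on the right does not depend on \<open>q\<close>, unlike the support of
  the samples, so the sum can be differentiated term by term.\<close>

lemma expectation_samples_eq_sum:
  assumes "\<And>i. i < p \<Longrightarrow> \<bar>q i\<bar> \<le> 1"
  shows "E (pair_pmf (iid_pmf n (cube_pmf p q)) (iid_pmf m (cube_pmf p q))) (\<lambda>(x, w). f x w)
    = (\<Sum>(x, w)\<in>datasets p n \<times> datasets p m. (\<Prod>y\<leftarrow>x @ w. cube_weight p q y) * f x w)"
proof -
  have w: "pmf (iid_pmf k (cube_pmf p q)) x = (\<Prod>y\<leftarrow>x. cube_weight p q y)" if "x \<in> datasets p k" for x k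
  proof -
    have "pmf (iid_pmf k (cube_pmf p q)) x = (\<Prod>y\<leftarrow>x. pmf (cube_pmf p q) y)"
      using that by (intro pmf_iid_pmf) (auto simp: datasets_def)
    also have "\<dots> = (\<Prod>y\<leftarrow>x. cube_weight p q y)"
      using that pmf_cube_pmf[OF assms]
      by (intro arg_cong[where f = prod_list] map_cong) (auto simp: datasets_def)
    finally show ?thesis .
  qed
  show ?thesis
    using set_iid_cube_pmf[of n p q] set_iid_cube_pmf[of m p q]
    by (subst integral_measure_pmf_real[where A = "datasets p n \<times> datasets p m"])
      (auto simp: finite_datasets pmf_pair w mult_ac intro!: sum.cong)
qed

text \<open>Only factor \<open>i\<close> depends on \<open>t\<close>. The condition on
  \<open>q i\<close> keeps the denominator of the score away from zero.\<close>

lemma cube_weight_has_derivative: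
  assumes "i < p" "y \<in> cube p" "\<bar>q i\<bar> < 1"
  shows "((\<lambda>t. cube_weight p (q(i := t)) y) has_real_derivative cube_weight p q y * score (q i) (y i)) (at (q i))"
proof -
  define R where "R = (\<Prod>k\<in>{..<p} - {i}. (1 + q k * y k) / 2)"
  have eq: "cube_weight p (q(i := t)) y = (1 + t * y i) / 2 * R" for t
  proof -
    have "(\<Prod>k\<in>{..<p} - {i}. (1 + (q(i := t)) k * y k) / 2) = R"
      unfolding R_def by (intro prod.cong) auto
    moreover have "cube_weight p (q(i := t)) y
        = (1 + (q(i := t)) i * y i) / 2 * (\<Prod>k\<in>{..<p} - {i}. (1 + (q(i := t)) k * y k) / 2)"
      unfolding cube_weight_def using assms(1) by (intro prod.remove) auto
    ultimately show ?thesis by simp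
  qed
  have "y i \<in> {-1, 1}" using assms by (auto simp: cube_def)
  then have "1 + q i * y i \<noteq> 0" using assms(3) by auto
  then have *: "cube_weight p q y * score (q i) (y i) = y i / 2 * R"
    unfolding eq[of "q i", unfolded fun_upd_triv] score_def by (simp add: field_simps)
  show ?thesis
    unfolding eq * by (auto intro!: derivative_eq_intros)
qed

text \<open>Logarithmic derivatives add up; the multiplicative form avoids dividing by the
  factors.\<close>

lemma prod_list_has_derivative:
  fixes P :: "real \<Rightarrow> 'a \<Rightarrow> real"
  assumes "\<And>y. y \<in> set ys \<Longrightarrow> ((\<lambda>t. P t y) has_real_derivative P t\<^sub>0 y * s y) (at t\<^sub>0)"
  shows "((\<lambda>t. \<Prod>y\<leftarrow>ys. P t y) has_real_derivative (\<Prod>y\<leftarrow>ys. P t\<^sub>0 y) * (\<Sum>y\<leftarrow>ys. s y)) (at t\<^sub>0)"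
  using assms
proof (induction ys)
  case (Cons y ys)
  have "((\<lambda>t. P t y * (\<Prod>y\<leftarrow>ys. P t y)) has_real_derivative
      P t\<^sub>0 y * s y * (\<Prod>y\<leftarrow>ys. P t\<^sub>0 y) + (\<Prod>y\<leftarrow>ys. P t\<^sub>0 y) * (\<Sum>y\<leftarrow>ys. s y) * P t\<^sub>0 y) (at t\<^sub>0)"
    using Cons by (intro DERIV_mult) auto
  then show ?case by (simp add: algebra_simps)
qed simp

text \<open>Score identity: differentiating the weights inserts the total score of all private and
  public samples as a factor, while \<open>f\<close> stays untouched.\<close>

lemma samples_sum_has_derivative:
  assumes "i < p" "\<bar>q i\<bar> < 1"
  shows "((\<lambda>t. \<Sum>(x, w)\<in>datasets p n \<times> datasets p m. (\<Prod>y\<leftarrow>x @ w. cube_weight p (q(i := t)) y) * f x w)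
    has_real_derivative (\<Sum>(x, w)\<in>datasets p n \<times> datasets p m.
      (\<Prod>y\<leftarrow>x @ w. cube_weight p q y) * (f x w * (\<Sum>y\<leftarrow>x @ w. score (q i) (y i))))) (at (q i))"
  unfolding case_prod_unfold
proof (rule DERIV_sum)
  fix z assume z: "z \<in> datasets p n \<times> datasets p m"
  have "((\<lambda>t. \<Prod>y\<leftarrow>fst z @ snd z. cube_weight p (q(i := t)) y) has_real_derivative
      (\<Prod>y\<leftarrow>fst z @ snd z. cube_weight p (q(i := q i)) y) * (\<Sum>y\<leftarrow>fst z @ snd z. score (q i) (y i))) (at (q i))"
  proof (rule prod_list_has_derivative)
    fix y assume "y \<in> set (fst z @ snd z)"
    with z have "y \<in> cube p" by (auto simp: datasets_def)
    from cube_weight_has_derivative[of i p y q, OF assms(1) this assms(2)]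
    show "((\<lambda>t. cube_weight p (q(i := t)) y) has_real_derivative
      cube_weight p (q(i := q i)) y * score (q i) (y i)) (at (q i))" by simp
  qed
  then have "((\<lambda>t. \<Prod>y\<leftarrow>fst z @ snd z. cube_weight p (q(i := t)) y) has_real_derivative
      (\<Prod>y\<leftarrow>fst z @ snd z. cube_weight p q y) * (\<Sum>y\<leftarrow>fst z @ snd z. score (q i) (y i))) (at (q i))"
    by (simp only: fun_upd_triv)
  from DERIV_cmult_right[OF this, of "f (fst z) (snd z)"]
  show "((\<lambda>t. (\<Prod>y\<leftarrow>fst z @ snd z. cube_weight p (q(i := t)) y) * f (fst z) (snd z)) has_real_derivative
      (\<Prod>y\<leftarrow>fst z @ snd z. cube_weight p q y) *
        (f (fst z) (snd z) * (\<Sum>y\<leftarrow>fst z @ snd z. score (q i) (y i)))) (at (q i))"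
    by (simp only: mult_ac)
qed

section \<open>Moments of weighted sums of scores\<close>

text \<open>The scores of different coordinates are independent and centred. The coefficients
  \<open>c i\<close> will be the truncated answers, held fixed while the fresh sample
  \<open>y\<close> varies.\<close>

lemma second_moment_scores_le:
  assumes "\<And>i. i < p \<Longrightarrow> \<bar>q i\<bar> \<le> 1 / 2" "\<And>i. i < p \<Longrightarrow> \<bar>c i\<bar> \<le> \<tau>"
  shows "E (cube_pmf p q) (\<lambda>y. (\<Sum>i<p. c i * score (q i) (y i))\<^sup>2) \<le> \<tau>\<^sup>2 * (2 * p)"
proof -
  have "\<bar>q i\<bar> < 1" if "i < p" for i using assms(1)[OF that] by simp
  then have "E (cube_pmf p q) (\<lambda>y. (\<Sum>i<p. c i * score (q i) (y i))\<^sup>2)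
      = (\<Sum>i<p. E (bias_pmf (q i)) (\<lambda>v. (c i * score (q i) v)\<^sup>2))"
    unfolding cube_pmf_def
    by (intro second_moment_Pi_pmf) (auto simp: finite_set_bias_pmf expectation_score)
  also have "\<dots> = (\<Sum>i<p. (c i)\<^sup>2 * E (bias_pmf (q i)) (\<lambda>v. (score (q i) v)\<^sup>2))"
    by (simp add: power_mult_distrib)
  also have "\<dots> \<le> (\<Sum>i<p. \<tau>\<^sup>2 * 2)"
    using assms(2) power_mono[OF assms(2), of _ 2]
    by (intro sum_mono mult_mono expectation_score_square_le assms(1) integral_nonneg_AE) auto
  finally show ?thesis by (simp add: algebra_simps)
qed

lemma expectation_abs_sum_score_le:
  assumes "i < p" "\<bar>q i\<bar> \<le> 1 / 2"
  shows "E (iid_pmf m (cube_pmf p q)) (\<lambda>w. \<bar>\<Sum>y\<leftarrow>w. score (q i) (y i)\<bar>) \<le> sqrt (2 * m)"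
proof (rule expectation_abs_le_sqrt)
  have "E (iid_pmf m (cube_pmf p q)) (\<lambda>w. (\<Sum>y\<leftarrow>w. score (q i) (y i))\<^sup>2)
      = m * E (bias_pmf (q i)) (\<lambda>v. (score (q i) v)\<^sup>2)"
    using assms expectation_cube_pmf_coord[OF assms(1), of q "score (q i)"]
      expectation_cube_pmf_coord[OF assms(1), of q "\<lambda>v. (score (q i) v)\<^sup>2"]
    by (subst second_moment_iid_pmf) (auto simp: finite_set_cube_pmf expectation_score)
  also have "\<dots> \<le> real m * 2"
    using expectation_score_square_le[OF assms(2)] by (intro mult_left_mono) auto
  finally show "E (iid_pmf m (cube_pmf p q)) (\<lambda>w. (\<Sum>y\<leftarrow>w. score (q i) (y i))\<^sup>2) \<le> 2 * m" by simp
qed (simp add: finite_set_iid_pmf finite_set_cube_pmf)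

lemma borel_measurable_prod_list_map:
  fixes f :: "'a \<Rightarrow> 'b \<Rightarrow> real"
  assumes "\<And>y. y \<in> set ys \<Longrightarrow> (\<lambda>x. f x y) \<in> borel_measurable M"
  shows "(\<lambda>x. \<Prod>y\<leftarrow>ys. f x y) \<in> borel_measurable M"
  using assms by (induction ys) auto

lemma borel_measurable_sum_list_map:
  fixes f :: "'a \<Rightarrow> 'b \<Rightarrow> real"
  assumes "\<And>y. y \<in> set ys \<Longrightarrow> (\<lambda>x. f x y) \<in> borel_measurable M"
  shows "(\<lambda>x. \<Sum>y\<leftarrow>ys. f x y) \<in> borel_measurable M"
  using assms by (induction ys) auto

lemma abs_sum_list_map_le:
  fixes s :: "'a \<Rightarrow> real"
  assumes "\<And>y. y \<in> set ys \<Longrightarrow> \<bar>s y\<bar> \<le> B"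
  shows "\<bar>\<Sum>y\<leftarrow>ys. s y\<bar> \<le> B * length ys"
  using assms
proof (induction ys)
  case (Cons y ys)
  have "\<bar>s y + (\<Sum>y\<leftarrow>ys. s y)\<bar> \<le> B + B * length ys"
    using Cons by (intro order_trans[OF abs_triangle_ineq] add_mono) auto
  then show ?case by (simp add: algebra_simps)
qed simp

section \<open>The fingerprinting argument\<close>

text \<open>The half-width \<open>\<tau>\<close> of the box is left free. The bound
  \<open>\<tau> \<le> 1 / 2\<close> keeps scores within 2, and \<open>\<alpha> \<le> \<tau>\<close>
  makes \<open>2 * \<tau> - \<alpha>\<close> nonnegative.\<close>

locale pap_release =
  fixes p n m :: nat and \<alpha> \<tau> :: real
    and A :: "(nat \<Rightarrow> real) list \<Rightarrow> (nat \<Rightarrow> real) list \<Rightarrow> (nat \<Rightarrow> real) measure"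
  assumes \<alpha>: "0 < \<alpha>" "\<alpha> \<le> \<tau>" and \<tau>: "\<tau> \<le> 1 / 2" and n: "1 \<le> n"
    and algorithm: "pap_algorithm p n m A"
    and dp: "dp_private p n m 1 (1 / (4 * real n)) A"
    and accurate: "pap_accurate p n m \<alpha> \<alpha> A"
begin

lemma \<tau>_pos: "0 < \<tau>"
  using \<alpha> by linarith

definition est :: "(nat \<Rightarrow> real) list \<Rightarrow> (nat \<Rightarrow> real) list \<Rightarrow> nat \<Rightarrow> real" where
  "est x w i = (\<integral>G. trunc_at \<tau> (G i) \<partial>A x w)"

definition samples :: "(nat \<Rightarrow> real) \<Rightarrow> ((nat \<Rightarrow> real) list \<times> (nat \<Rightarrow> real) list) pmf" where
  "samples q = pair_pmf (iid_pmf n (cube_pmf p q)) (iid_pmf m (cube_pmf p q))"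

lemma finite_set_samples: "finite (set_pmf (samples q))"
  by (simp add: samples_def finite_set_iid_pmf finite_set_cube_pmf)

lemma set_samples: "set_pmf (samples q) \<subseteq> datasets p n \<times> datasets p m"
  using set_iid_cube_pmf by (auto simp: samples_def)

context
  fixes x w
  assumes xw: "x \<in> datasets p n" "w \<in> datasets p m"
begin

lemma prob_space_A: "prob_space (A x w)"
  using algorithm xw by (auto simp: pap_algorithm_def)

lemma sets_A: "sets (A x w) = sets (out_space p)"
  using algorithm xw by (auto simp: pap_algorithm_def)

lemma measurable_trunc_at_A: "i < p \<Longrightarrow> (\<lambda>G. trunc_at \<tau> (G i)) \<in> borel_measurable (A x w)"
  unfolding measurable_cong_sets[OF sets_A refl] out_space_def by measurable

lemma integrable_trunc_at_A: "i < p \<Longrightarrow> integrable (A x w) (\<lambda>G. trunc_at \<tau> (G i))"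
proof -
  interpret prob_space "A x w" by (rule prob_space_A)
  show "i < p \<Longrightarrow> ?thesis"
    using abs_trunc_at_le \<tau>_pos
    by (intro integrable_const_bound[where B = \<tau>] measurable_trunc_at_A) auto
qed

lemma abs_est_le: "i < p \<Longrightarrow> \<bar>est x w i\<bar> \<le> \<tau>"
proof -
  interpret prob_space "A x w" by (rule prob_space_A)
  assume i: "i < p"
  have "\<bar>est x w i\<bar> \<le> (\<integral>G. \<bar>trunc_at \<tau> (G i)\<bar> \<partial>A x w)"
    unfolding est_def using integral_norm_bound[of "A x w" "\<lambda>G. trunc_at \<tau> (G i)"] by simp
  also have "\<dots> \<le> \<tau>"
    using abs_trunc_at_le \<tau>_pos i integrable_trunc_at_A by (intro integral_le_const) auto
  finally show ?thesis .
qed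

lemma accurate_set_measurable: "accurate_set p \<alpha> D \<in> sets (A x w)"
  unfolding sets_A accurate_set_def out_space_def by measurable

lemma integrable_accurate: "integrable (A x w) (indicator (accurate_set p \<alpha> D) :: _ \<Rightarrow> real)"
proof -
  interpret prob_space "A x w" by (rule prob_space_A)
  show ?thesis
    using accurate_set_measurable by (intro integrable_real_indicator) (auto simp: less_top[symmetric])
qed

text \<open>If the true mean is \<tau>, the truncated answer is at least
  \<open>\<tau> - \<alpha>\<close> on the accurate event and at least \<open>- \<tau>\<close>
  elsewhere.\<close>

lemma est_ge:
  assumes i: "i < p" and "E D (stump i) = \<tau>"
  shows "- \<tau> + (2 * \<tau> - \<alpha>) * measure (A x w) (accurate_set p \<alpha> D) \<le> est x w i"
proof -
  interpret prob_space "A x w" by (rule prob_space_A)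
  have "(\<integral>G. - \<tau> + (2 * \<tau> - \<alpha>) * indicator (accurate_set p \<alpha> D) G \<partial>A x w) \<le> est x w i"
    unfolding est_def
  proof (rule integral_mono)
    fix G
    show "- \<tau> + (2 * \<tau> - \<alpha>) * indicator (accurate_set p \<alpha> D) G \<le> trunc_at \<tau> (G i)"
      using assms \<tau>_pos \<alpha> by (force simp: indicator_def accurate_set_def trunc_at_def)
  qed (use integrable_accurate integrable_trunc_at_A i in auto)
  then show ?thesis
    using integrable_accurate[of D] accurate_set_measurable[of D] by (simp add: prob_space)
qed

lemma est_le:
  assumes i: "i < p" and "E D (stump i) = - \<tau>"
  shows "est x w i \<le> \<tau> - (2 * \<tau> - \<alpha>) * measure (A x w) (accurate_set p \<alpha> D)"
proof -
  interpret prob_space "A x w" by (rule prob_space_A)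
  have "est x w i \<le> (\<integral>G. \<tau> - (2 * \<tau> - \<alpha>) * indicator (accurate_set p \<alpha> D) G \<partial>A x w)"
    unfolding est_def
  proof (rule integral_mono)
    fix G
    show "trunc_at \<tau> (G i) \<le> \<tau> - (2 * \<tau> - \<alpha>) * indicator (accurate_set p \<alpha> D) G"
      using assms \<tau>_pos \<alpha> by (force simp: indicator_def accurate_set_def trunc_at_def)
  qed (use integrable_accurate integrable_trunc_at_A i in auto)
  then show ?thesis
    using integrable_accurate[of D] accurate_set_measurable[of D] by (simp add: prob_space)
qed

end

section \<open>Accuracy on opposite faces of the box\<close>

lemma expectation_stump:
  assumes "i < p" "\<bar>q i\<bar> \<le> 1"
  shows "E (cube_pmf p q) (stump i) = q i"
  using expectation_cube_pmf_coord[OF assms(1), of q "\<lambda>v. v"] assms(2)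
  by (simp add: stump_def[abs_def] expectation_bias_pmf field_simps)

lemma expectation_accurate_ge:
  "1 - \<alpha> \<le> E (samples q) (\<lambda>(x, w). measure (A x w) (accurate_set p \<alpha> (cube_pmf p q)))"
  using accurate set_cube_pmf[of p q] by (simp add: pap_accurate_def samples_def)

lemma expectation_est_ge:
  assumes i: "i < p" and q: "q i = \<tau>"
  shows "\<tau> - \<alpha> - 2 * \<tau> * \<alpha> \<le> E (samples q) (\<lambda>(x, w). est x w i)"
proof -
  define acc where "acc = E (samples q) (\<lambda>(x, w). measure (A x w) (accurate_set p \<alpha> (cube_pmf p q)))"
  have "(2 * \<tau> - \<alpha>) * (1 - \<alpha>) \<le> (2 * \<tau> - \<alpha>) * acc"
    using \<alpha> \<tau>_pos by (intro mult_left_mono) (auto simp: acc_def expectation_accurate_ge)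
  \<comment> \<open>Expanding the product leaves an extra \<open>\<alpha>\<^sup>2\<close>, which is
    dropped.\<close>
  then have "\<tau> - \<alpha> - 2 * \<tau> * \<alpha> \<le> - \<tau> + (2 * \<tau> - \<alpha>) * acc"
    using zero_le_square[of \<alpha>] by (simp only: algebra_simps)
  also have "\<dots> = E (samples q) (\<lambda>(x, w). - \<tau> + (2 * \<tau> - \<alpha>) * measure (A x w) (accurate_set p \<alpha> (cube_pmf p q)))"
    by (simp add: acc_def case_prod_unfold integrable_measure_pmf_finite finite_set_samples)
  also have "\<dots> \<le> E (samples q) (\<lambda>(x, w). est x w i)"
    using set_samples[of q] est_ge[OF _ _ i, of _ _ "cube_pmf p q"] expectation_stump[OF i, of q] q \<tau> \<tau>_pos
    by (intro expectation_mono_finite finite_set_samples) auto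
  finally show ?thesis .
qed

lemma expectation_est_le:
  assumes i: "i < p" and q: "q i = - \<tau>"
  shows "E (samples q) (\<lambda>(x, w). est x w i) \<le> - (\<tau> - \<alpha> - 2 * \<tau> * \<alpha>)"
proof -
  define acc where "acc = E (samples q) (\<lambda>(x, w). measure (A x w) (accurate_set p \<alpha> (cube_pmf p q)))"
  have "(2 * \<tau> - \<alpha>) * (1 - \<alpha>) \<le> (2 * \<tau> - \<alpha>) * acc"
    using \<alpha> \<tau>_pos by (intro mult_left_mono) (auto simp: acc_def expectation_accurate_ge)
  then have *: "\<tau> - (2 * \<tau> - \<alpha>) * acc \<le> - (\<tau> - \<alpha> - 2 * \<tau> * \<alpha>)"
    using zero_le_square[of \<alpha>] by (simp only: algebra_simps)
  have "E (samples q) (\<lambda>(x, w). est x w i)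
      \<le> E (samples q) (\<lambda>(x, w). \<tau> - (2 * \<tau> - \<alpha>) * measure (A x w) (accurate_set p \<alpha> (cube_pmf p q)))"
    using set_samples[of q] est_le[OF _ _ i, of _ _ "cube_pmf p q"] expectation_stump[OF i, of q] q \<tau> \<tau>_pos
    by (intro expectation_mono_finite finite_set_samples) auto
  also have "\<dots> = \<tau> - (2 * \<tau> - \<alpha>) * acc"
    by (simp add: acc_def case_prod_unfold integrable_measure_pmf_finite finite_set_samples)
  finally show ?thesis using * by linarith
qed

section \<open>Upper bounds on the correlations with the scores\<close>

context
  fixes q :: "nat \<Rightarrow> real"
  assumes q: "\<And>i. i < p \<Longrightarrow> \<bar>q i\<bar> \<le> 1 / 2"
begin

text \<open>For a fixed answer vector, its correlation with a fresh sample is a centred sum of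
  independent terms, of mean absolute value at most \<open>\<tau> * sqrt (2 * p)\<close>. The
  additive privacy error meets the worst case \<open>\<tau> * 2 * p\<close>, and
  \<open>\<delta> = 1 / (4 * n)\<close> turns that into \<open>\<tau> * p / n\<close>.\<close>

lemma private_correlation_le:
  assumes w: "w \<in> datasets p m" and "j < n"
  shows "E (iid_pmf n (cube_pmf p q)) (\<lambda>x. \<Sum>i<p. est x w i * score (q i) ((x ! j) i))
    \<le> 2 * (\<tau> * sqrt (2 * p)) + \<tau> * p / n"
proof -
  define \<phi> where "\<phi> y G = (\<Sum>i<p. trunc_at \<tau> (G i) * score (q i) (y i))" for y G :: "nat \<Rightarrow> real"
  note D = set_iid_cube_pmf[of n p q, THEN subsetD]
  have y: "y i \<in> {-1, 1}" if "y \<in> set_pmf (cube_pmf p q)" "i < p" for y i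
    using set_cube_pmf[of p q] that by (auto simp: cube_def)
  have score: "\<bar>q i\<bar> < 1" if "i < p" for i
    using q[OF that] by simp
  have "E (iid_pmf n (cube_pmf p q)) (\<lambda>x. \<Sum>i<p. est x w i * score (q i) ((x ! j) i))
      = E (iid_pmf n (cube_pmf p q)) (\<lambda>x. \<integral>G. \<phi> (x ! j) G \<partial>A x w)"
    using integrable_trunc_at_A[OF D w]
    by (intro expectation_cong) (simp add: \<phi>_def est_def)
  also have "\<dots> \<le> (exp 1 - 1) * (\<tau> * sqrt (2 * p)) + 2 * (1 / (4 * n)) * (\<tau> * 2 * p)"
  proof (rule dp_correlation_le[where N = "out_space p"])
    show "\<phi> y \<in> borel_measurable (out_space p)" for y
      unfolding \<phi>_def out_space_def by measurable
    show "\<bar>\<phi> y G\<bar> \<le> \<tau> * 2 * p" if "y \<in> set_pmf (cube_pmf p q)" for y G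
    proof -
      have "\<bar>\<phi> y G\<bar> \<le> (\<Sum>i<p. \<bar>trunc_at \<tau> (G i)\<bar> * \<bar>score (q i) (y i)\<bar>)"
        unfolding \<phi>_def abs_mult[symmetric] by (rule sum_abs)
      also have "\<dots> \<le> (\<Sum>i<p. \<tau> * 2)"
        using \<tau>_pos y[OF that] q by (intro sum_mono mult_mono abs_trunc_at_le abs_score_le) auto
      finally show ?thesis by (simp add: mult_ac)
    qed
    show "E (cube_pmf p q) (\<lambda>y. \<phi> y G) = 0" for G
    proof -
      have "E (cube_pmf p q) (\<lambda>y. score (q i) (y i)) = 0" if "i < p" for i
        using that score by (simp add: expectation_cube_pmf_coord expectation_score)
      then show ?thesis
        unfolding \<phi>_def by (simp add: integrable_measure_pmf_finite finite_set_cube_pmf)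
    qed
    show "E (cube_pmf p q) (\<lambda>y. \<bar>\<phi> y G\<bar>) \<le> \<tau> * sqrt (2 * p)" for G
    proof -
      have "E (cube_pmf p q) (\<lambda>y. \<bar>\<phi> y G\<bar>) \<le> sqrt (\<tau>\<^sup>2 * (2 * p))"
        unfolding \<phi>_def using q \<tau>_pos
        by (intro expectation_abs_le_sqrt finite_set_cube_pmf second_moment_scores_le abs_trunc_at_le) auto
      then show ?thesis using \<tau>_pos by (simp add: real_sqrt_mult)
    qed
    show "measure (A x w) Z \<le> exp 1 * measure (A x' w) Z + 1 / (4 * n)"
      if "x \<in> set_pmf (iid_pmf n (cube_pmf p q))" "x' \<in> set_pmf (iid_pmf n (cube_pmf p q))"
        "neighbours x x'" "Z \<in> sets (out_space p)" for x x' Z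
      using dp w D[OF that(1)] D[OF that(2)] that(3,4) by (simp add: dp_private_def)
  qed (use D w prob_space_A sets_A \<open>j < n\<close> in \<open>auto simp: finite_set_cube_pmf\<close>)
  also have "\<dots> \<le> 2 * (\<tau> * sqrt (2 * p)) + \<tau> * p / n"
    \<comment> \<open>The factor 2 comes from \<open>exp 1 \<le> 3\<close>.\<close>
    using exp_le \<tau>_pos n by (intro add_mono mult_right_mono) (auto simp: field_simps)
  finally show ?thesis .
qed

lemma private_correlations_le:
  "E (samples q) (\<lambda>(x, w). \<Sum>i<p. est x w i * (\<Sum>y\<leftarrow>x. score (q i) (y i)))
    \<le> n * (2 * (\<tau> * sqrt (2 * p))) + \<tau> * p"
proof -
  let ?D = "\<lambda>k. iid_pmf k (cube_pmf p q)"
  have fin: "finite (set_pmf (?D k))" for k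
    by (simp add: finite_set_iid_pmf finite_set_cube_pmf)
  have "E (samples q) (\<lambda>(x, w). \<Sum>i<p. est x w i * (\<Sum>y\<leftarrow>x. score (q i) (y i)))
      = E (samples q) (\<lambda>(x, w). \<Sum>j<n. \<Sum>i<p. est x w i * score (q i) ((x ! j) i))"
  proof (rule expectation_cong)
    fix z assume "z \<in> set_pmf (samples q)"
    with set_samples have "length (fst z) = n" by (force simp: datasets_def)
    then have "(\<Sum>i<p. est (fst z) (snd z) i * (\<Sum>y\<leftarrow>fst z. score (q i) (y i)))
        = (\<Sum>i<p. \<Sum>j<n. est (fst z) (snd z) i * score (q i) ((fst z ! j) i))"
      by (simp add: sum_list_sum_nth sum_distrib_left atLeast0LessThan)
    also have "\<dots> = (\<Sum>j<n. \<Sum>i<p. est (fst z) (snd z) i * score (q i) ((fst z ! j) i))"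
      by (rule sum.swap)
    finally show "(case z of (x, w) \<Rightarrow> \<Sum>i<p. est x w i * (\<Sum>y\<leftarrow>x. score (q i) (y i)))
        = (case z of (x, w) \<Rightarrow> \<Sum>j<n. \<Sum>i<p. est x w i * score (q i) ((x ! j) i))"
      by (simp add: case_prod_unfold)
  qed
  \<comment> \<open>The public samples become the outer average, since privacy is available for each
    fixed \<open>w\<close>.\<close>
  also have "\<dots> = E (?D m) (\<lambda>w. \<Sum>j<n. E (?D n) (\<lambda>x. \<Sum>i<p. est x w i * score (q i) ((x ! j) i)))"
    unfolding samples_def
    by (simp only: expectation_pair_finite fin case_prod_conv expectation_swap_finite[of "?D n" "?D m"])
      (simp add: integrable_measure_pmf_finite fin)
  also have "\<dots> \<le> E (?D m) (\<lambda>w. \<Sum>j<n. 2 * (\<tau> * sqrt (2 * p)) + \<tau> * p / n)"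
    using set_iid_cube_pmf[of m p q]
    by (intro expectation_mono_finite fin sum_mono private_correlation_le) auto
  also have "\<dots> = n * (2 * (\<tau> * sqrt (2 * p))) + \<tau> * p"
    using n by (simp add: field_simps)
  finally show ?thesis .
qed

text \<open>Without privacy for \<open>w\<close>, the truncated answer is bounded by \<tau> and only
  the fluctuation of the total score remains.\<close>

lemma public_correlation_le:
  assumes i: "i < p"
  shows "E (samples q) (\<lambda>(x, w). est x w i * (\<Sum>y\<leftarrow>w. score (q i) (y i))) \<le> \<tau> * sqrt (2 * m)"
proof -
  have "E (samples q) (\<lambda>(x, w). est x w i * (\<Sum>y\<leftarrow>w. score (q i) (y i)))
      \<le> E (samples q) (\<lambda>(x, w). \<tau> * \<bar>\<Sum>y\<leftarrow>w. score (q i) (y i)\<bar>)"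
  proof (intro expectation_mono_finite finite_set_samples, clarify)
    fix x w assume "(x, w) \<in> set_pmf (samples q)"
    with set_samples have "x \<in> datasets p n" "w \<in> datasets p m" by auto
    then have "\<bar>est x w i\<bar> \<le> \<tau>" using i by (rule abs_est_le)
    then have "\<bar>est x w i * (\<Sum>y\<leftarrow>w. score (q i) (y i))\<bar> \<le> \<tau> * \<bar>\<Sum>y\<leftarrow>w. score (q i) (y i)\<bar>"
      unfolding abs_mult by (rule mult_right_mono) simp
    then show "est x w i * (\<Sum>y\<leftarrow>w. score (q i) (y i)) \<le> \<tau> * \<bar>\<Sum>y\<leftarrow>w. score (q i) (y i)\<bar>" by linarith
  qed
  also have "\<dots> = \<tau> * E (iid_pmf m (cube_pmf p q)) (\<lambda>w. \<bar>\<Sum>y\<leftarrow>w. score (q i) (y i)\<bar>)"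
    unfolding samples_def
    using expectation_pair_pmf_snd[of "iid_pmf n (cube_pmf p q)" "iid_pmf m (cube_pmf p q)"
        "\<lambda>w. \<tau> * \<bar>\<Sum>y\<leftarrow>w. score (q i) (y i)\<bar>"]
    by (simp add: case_prod_unfold)
  also have "\<dots> \<le> \<tau> * sqrt (2 * m)"
    using \<tau>_pos q[OF i] i by (intro mult_left_mono expectation_abs_sum_score_le) auto
  finally show ?thesis .
qed

lemma correlations_le:
  "(\<Sum>i<p. E (samples q) (\<lambda>(x, w). est x w i * (\<Sum>y\<leftarrow>x @ w. score (q i) (y i))))
    \<le> 2 * n * \<tau> * sqrt (2 * p) + \<tau> * p + p * (\<tau> * sqrt (2 * m))"
proof -
  have "(\<Sum>i<p. E (samples q) (\<lambda>(x, w). est x w i * (\<Sum>y\<leftarrow>x @ w. score (q i) (y i))))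
      = E (samples q) (\<lambda>(x, w). \<Sum>i<p. est x w i * (\<Sum>y\<leftarrow>x. score (q i) (y i)))
        + (\<Sum>i<p. E (samples q) (\<lambda>(x, w). est x w i * (\<Sum>y\<leftarrow>w. score (q i) (y i))))"
    by (simp add: case_prod_unfold distrib_left integrable_measure_pmf_finite finite_set_samples sum.distrib)
  also have "\<dots> \<le> (n * (2 * (\<tau> * sqrt (2 * p))) + \<tau> * p) + (\<Sum>i<p. \<tau> * sqrt (2 * m))"
    by (intro add_mono sum_mono private_correlations_le public_correlation_le) auto
  finally show ?thesis by (simp add: algebra_simps)
qed

text \<open>A crude bound, uniform in \<open>q\<close>, that provides integrability in the average
  over the box.\<close>

lemma abs_correlation_le:
  assumes i: "i < p"
  shows "\<bar>E (samples q) (\<lambda>(x, w). est x w i * (\<Sum>y\<leftarrow>x @ w. score (q i) (y i)))\<bar> \<le> \<tau> * (2 * real (n + m))"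
proof -
  have "\<bar>E (samples q) (\<lambda>(x, w). est x w i * (\<Sum>y\<leftarrow>x @ w. score (q i) (y i)))\<bar>
      \<le> E (samples q) (\<lambda>(x, w). \<bar>est x w i * (\<Sum>y\<leftarrow>x @ w. score (q i) (y i))\<bar>)"
    using integral_norm_bound[of "measure_pmf (samples q)" "\<lambda>(x, w). est x w i * (\<Sum>y\<leftarrow>x @ w. score (q i) (y i))"]
    by (simp add: case_prod_unfold)
  also have "\<dots> \<le> E (samples q) (\<lambda>_. \<tau> * (2 * real (n + m)))"
  proof (intro expectation_mono_finite finite_set_samples, clarify)
    fix x w assume "(x, w) \<in> set_pmf (samples q)"
    with set_samples have xw: "x \<in> datasets p n" "w \<in> datasets p m" by auto
    have "\<bar>score (q i) (y i)\<bar> \<le> 2" if "y \<in> set (x @ w)" for y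
      using that xw i q[OF i] by (intro abs_score_le) (auto simp: datasets_def cube_def subset_iff)
    then have "\<bar>\<Sum>y\<leftarrow>x @ w. score (q i) (y i)\<bar> \<le> 2 * real (length (x @ w))"
      by (rule abs_sum_list_map_le)
    also have "length (x @ w) = n + m" using xw by (simp add: datasets_def)
    finally show "\<bar>est x w i * (\<Sum>y\<leftarrow>x @ w. score (q i) (y i))\<bar> \<le> \<tau> * (2 * real (n + m))"
      unfolding abs_mult using abs_est_le[OF xw i] \<tau>_pos by (intro mult_mono) auto
  qed
  finally show ?thesis by simp
qed

end

text \<open>Both sides estimate the summed correlations at one well-chosen \<open>q\<close>: from
  below through the climb of the expected answers across the box, from above through
  \<open>correlations_le\<close>.\<close>

lemma fingerprinting_bound:
  "p * ((\<tau> - \<alpha> - 2 * \<tau> * \<alpha>) / \<tau>) \<le> 2 * n * \<tau> * sqrt (2 * p) + \<tau> * p + p * (\<tau> * sqrt (2 * m))"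
proof -
  define Q where "Q = {..<p} \<rightarrow>\<^sub>E {-\<tau>..\<tau>}"
  \<comment> \<open>Both functions are given by the polynomial weights, for all \<open>q\<close>, to
    have derivatives and measurability; on the box they equal expectations over the samples.\<close>
  define g where "g i q = (\<Sum>(x, w)\<in>datasets p n \<times> datasets p m.
    (\<Prod>y\<leftarrow>x @ w. cube_weight p q y) * est x w i)" for i q
  define F where "F i q = (\<Sum>(x, w)\<in>datasets p n \<times> datasets p m.
    (\<Prod>y\<leftarrow>x @ w. cube_weight p q y) * (est x w i * (\<Sum>y\<leftarrow>x @ w. score (q i) (y i))))" for i q
  have Q: "\<bar>q i\<bar> \<le> \<tau>" "\<bar>q i\<bar> \<le> 1 / 2" "\<bar>q i\<bar> \<le> 1" if "q \<in> Q" "i < p" for q i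
  proof -
    have "q i \<in> {-\<tau>..\<tau>}" using that by (auto simp: Q_def PiE_iff)
    then show "\<bar>q i\<bar> \<le> \<tau>" by auto
    then show "\<bar>q i\<bar> \<le> 1 / 2" "\<bar>q i\<bar> \<le> 1" using \<tau> by linarith+
  qed
  have g: "g i q = E (samples q) (\<lambda>(x, w). est x w i)" if "\<And>i. i < p \<Longrightarrow> \<bar>q i\<bar> \<le> 1" for i q
    unfolding g_def samples_def using that by (rule expectation_samples_eq_sum[symmetric])
  have F: "F i q = E (samples q) (\<lambda>(x, w). est x w i * (\<Sum>y\<leftarrow>x @ w. score (q i) (y i)))"
    if "q \<in> Q" for i q
    unfolding F_def samples_def using Q(3)[OF that] by (rule expectation_samples_eq_sum[symmetric])
  have "\<exists>q\<in>Q. p * (2 * (\<tau> - \<alpha> - 2 * \<tau> * \<alpha>) / (2 * \<tau>)) \<le> (\<Sum>i<p. F i q)"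
  proof (rule exists_box_divergence_ge[where p = p and \<tau> = \<tau> and g = g and K = "\<tau> * (2 * real (n + m))", folded Q_def])
    show "0 < \<tau>" by (rule \<tau>_pos)
    show "F i \<in> borel_measurable (PiM {..<p} (\<lambda>_. borel))" if "i < p" for i
      unfolding F_def case_prod_unfold cube_weight_def score_def using that
      by (intro borel_measurable_sum borel_measurable_times borel_measurable_prod_list_map
          borel_measurable_sum_list_map) measurable
    show "\<bar>F i q\<bar> \<le> \<tau> * (2 * real (n + m))" if "i < p" "q \<in> Q" for i q
      unfolding F[OF that(2)] using Q(2)[OF that(2)] that(1) by (rule abs_correlation_le)
    show "((\<lambda>t. g i (q(i := t))) has_real_derivative F i q) (at (q i))" if "i < p" "q \<in> Q" for i q
      unfolding g_def F_def using that(1) Q(2)[OF that(2,1)] by (intro samples_sum_has_derivative) auto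
    show "2 * (\<tau> - \<alpha> - 2 * \<tau> * \<alpha>) \<le> g i (q(i := \<tau>)) - g i (q(i := - \<tau>))" if "i < p" "q \<in> Q" for i q
    proof -
      \<comment> \<open>Moving coordinate \<open>i\<close> to a face keeps all means admissible, so
        \<open>g\<close> there is an expectation to which accuracy applies.\<close>
      have "\<bar>(q(i := t)) k\<bar> \<le> 1" if "\<bar>t\<bar> \<le> \<tau>" "k < p" for t k
        using Q(3)[OF \<open>q \<in> Q\<close>, of k] that \<tau> by auto
      then show ?thesis
        using expectation_est_ge[of i "q(i := \<tau>)"] expectation_est_le[of i "q(i := - \<tau>)"] \<tau>_pos \<open>i < p\<close>
        by (subst (1 2) g) auto
    qed
  qed
  then obtain q where q: "q \<in> Q" and le: "p * (2 * (\<tau> - \<alpha> - 2 * \<tau> * \<alpha>) / (2 * \<tau>)) \<le> (\<Sum>i<p. F i q)" by blast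
  have "p * ((\<tau> - \<alpha> - 2 * \<tau> * \<alpha>) / \<tau>) \<le> (\<Sum>i<p. F i q)"
    using le \<tau>_pos by (simp only: mult_divide_mult_cancel_left_if) simp
  also have "\<dots> \<le> 2 * n * \<tau> * sqrt (2 * p) + \<tau> * p + p * (\<tau> * sqrt (2 * m))"
    unfolding F[OF q] using Q(2)[OF q] by (rule correlations_le)
  finally show ?thesis .
qed

end

section \<open>Choice of constants\<close>

theorem theorem4p2:
  shows "\<exists>c>0. \<exists>\<alpha>0>0. \<exists>k::nat.
    \<forall>(p::nat) (\<alpha>::real) (n::nat) (m::nat)
      (A :: (nat \<Rightarrow> real) list \<Rightarrow> (nat \<Rightarrow> real) list \<Rightarrow> (nat \<Rightarrow> real) measure).
      0 < \<alpha> \<and> \<alpha> \<le> \<alpha>0 \<and> 1 \<le> n \<and>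
      pap_algorithm p n m A \<and>
      dp_private p n m 1 (1 / (4 * real n)) A \<and>
      pap_accurate p n m \<alpha> \<alpha> A
      \<longrightarrow> real n * (ln (2 + real p + 1 / \<alpha>)) ^ k \<ge> c * sqrt (real p) / \<alpha>
          \<or> real m \<ge> c / \<alpha>\<^sup>2"
proof (rule exI[of _ "1 / 3200"], rule conjI, simp, rule exI[of _ "1 / 32"], rule conjI, simp,
    rule exI[of _ 0], intro allI impI, elim conjE, rule ccontr)
  \<comment> \<open>The logarithm gets exponent 0, so its power equals 1, and
    \<open>c = 1 / 3200\<close> serves both alternatives.\<close>
  fix p n m :: nat and \<alpha> :: real and A :: "(nat \<Rightarrow> real) list \<Rightarrow> (nat \<Rightarrow> real) list \<Rightarrow> (nat \<Rightarrow> real) measure"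
  assume alpha: "0 < \<alpha>" "\<alpha> \<le> 1 / 32"
    and "1 \<le> n" "pap_algorithm p n m A" "dp_private p n m 1 (1 / (4 * real n)) A" "pap_accurate p n m \<alpha> \<alpha> A"
    and contra: "\<not> (real n * ln (2 + real p + 1 / \<alpha>) ^ 0 \<ge> 1 / 3200 * sqrt (real p) / \<alpha> \<or> real m \<ge> 1 / 3200 / \<alpha>\<^sup>2)"
  \<comment> \<open>With half-width \<open>4 * \<alpha>\<close> the lower bound per coordinate is
    \<open>3 / 4 - 2 * \<alpha>\<close>; the bound \<open>\<alpha> \<le> 1 / 32\<close> gives
    \<open>4 * \<alpha> \<le> 1 / 8\<close>.\<close>
  then interpret pap_release p n m \<alpha> "4 * \<alpha>" A
    by unfold_locales auto
  have n: "real n * \<alpha> < sqrt p / 3200" and m: "real m < 1 / 3200 / \<alpha>\<^sup>2"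
    using contra alpha by (auto simp: field_simps)
  have p: "0 < p"
    using n alpha by (cases "p = 0") (auto simp: mult_less_0_iff)
  \<comment> \<open>The constant is fitted to \<open>2 / 3200 = (1 / 40)\<^sup>2\<close>.\<close>
  have "sqrt (2 * m) \<le> sqrt ((1 / (40 * \<alpha>))\<^sup>2)"
    using m by (intro real_sqrt_le_mono) (simp add: power2_eq_square)
  then have "4 * \<alpha> * sqrt (2 * m) \<le> 4 * \<alpha> * (1 / (40 * \<alpha>))"
    using alpha by (intro mult_left_mono) auto
  then have public_le: "p * (4 * \<alpha> * sqrt (2 * m)) \<le> p * (1 / 10)"
    using alpha by (intro mult_left_mono) auto
  have "sqrt (2 * p) \<le> 2 * sqrt p"
    by (rule real_le_lsqrt) (auto simp: power_mult_distrib)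
  then have "2 * n * (4 * \<alpha>) * sqrt (2 * p) \<le> 2 * n * (4 * \<alpha>) * (2 * sqrt p)"
    using alpha by (intro mult_left_mono) auto
  also have "\<dots> = 16 * (n * \<alpha>) * sqrt p" by simp
  also have "\<dots> \<le> 16 * (sqrt p / 3200) * sqrt p"
    using n by (intro mult_right_mono mult_left_mono) auto
  also have "\<dots> = p * (1 / 200)" by simp
  finally have private_le: "2 * n * (4 * \<alpha>) * sqrt (2 * p) \<le> p * (1 / 200)" .
  have "(4 * \<alpha> - \<alpha> - 2 * (4 * \<alpha>) * \<alpha>) / (4 * \<alpha>) = 3 / 4 - 2 * \<alpha>"
    using alpha by (simp add: field_simps)
  then have "p * (3 / 4 - 2 * \<alpha>) \<le> p * (1 / 200) + 4 * \<alpha> * p + p * (1 / 10)"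
    using fingerprinting_bound private_le public_le by simp
  also have "\<dots> = p * (1 / 200 + 4 * \<alpha> + 1 / 10)"
    by (simp add: algebra_simps)
  \<comment> \<open>Dividing by \<open>p > 0\<close> leaves an inequality that would force
    \<open>6 * \<alpha> \<ge> 0.645\<close>, whereas
    \<open>6 * \<alpha> \<le> 6 / 32\<close>.\<close>
  finally have "3 / 4 - 2 * \<alpha> \<le> 1 / 200 + 4 * \<alpha> + 1 / 10"
    using p by simp
  with alpha(2) show False by linarith
qed

end
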